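(* Let $d,n,d_1,\ldots,d_n$ be positive integers with $n>d$. Let $\mathcal{F}=\{X_1,\ldots,X_n\}$ with $X_i\in\mathbb{R}^{d\times d_i}$, $i\in[n]$, be a matrix frame, and let $\mathbf{c}=(c_1,\ldots,c_n)\in\mathbb{Q}^n_{>0}$ with $\sum_{i=1}^nc_i=d$. Let $t^*=(t_1^*,\ldots,t_n^* )\in\mathbb{R}^n$ and set $$Q(t^* ):=\sum_{i=1}^ne^{t_i^*}X_iX_i^T.$$ Then the following statements are equivalent: (1) $f_{\mathcal{F}}(\mathbf{c})$ is finite and the infimum defining it is attained at $t^*$; (2) $(e^{t_1^*},\ldots,e^{t_n^*})\in\mathbb{V}(\mathcal{F},\mathbf{c})$. If either (1) or (2) holds, then $Q(t^* )^{-\frac12}$ transforms $(\mathcal{F},\mathbf{c})$ into a radial isotropic matrix frame (RIF).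
   Context: $[n]=\{1,\ldots,n\}$; $\|\cdot\|_F$ is the Frobenius norm; $\langle\cdot,\cdot\rangle$ is the standard inner product. A tuple $\mathcal{F}=\{X_1,\ldots,X_n\}$ with $X_i\in\mathbb{R}^{d\times d_i}$ is a matrix frame if $\sum_{i=1}^nX_iX_i^T$ is positive definite. $(\mathcal{F},\mathbf{c})$ is a radial isotropic matrix frame (RIF) if all $X_i\neq0$ and $\sum_{i=1}^nc_i\frac{X_iX_i^T}{\|X_i\|_F^2}=I_d$. A matrix $A\in\mathrm{GL}(d,\mathbb{R})$ transforms $(\mathcal{F},\mathbf{c})$ into a RIF if $(\{AX_i\}_{i\in[n]},\mathbf{c})$ is a RIF. $\Phi_{\mathcal{F}}(t)=\log\det\left(\sum_{i=1}^ne^{t_i}X_iX_i^T\right)$ for $t\in\mathbb{R}^n$, and $f_{\mathcal{F}}(\mathbf{c})=\inf_{t\in\mathbb{R}^n}\{\Phi_{\mathcal{F}}(t)-\langle t,\mathbf{c}\rangle\}\in\mathbb{R}\cup\{-\infty\}$. Let $\mathcal{A}$ be the set of all pairs $(I,(S_i)_{i\in I})$ with $\emptyset\ne I\subseteq[n]$, $\emptyset\neq S_i\subseteq[d_i]$ for all $i\in I$, and $\sum_{i\in I}|S_i|=d$. For $S=(I,(S_\ell)_{\ell\in I})\in\mathcal{A}$ and $i\in[n]$, write $i\in S$ to mean $i\in I$, and put $$\Delta_S:=\det\Big(\sum_{\ell\in S}X[S_\ell]\,X[S_\ell]^T\Big),$$ where $X[S_\ell]$ is the submatrix of $X_\ell$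 consisting of the columns indexed by $S_\ell\subseteq[d_\ell]$. Define $$\mathbb{V}(\mathcal{F},\mathbf{c}):=\Big\{(\xi_1,\ldots,\xi_n)\in\mathbb{R}^n_{>0} : \sum_{S\in\mathcal{A},\,i\in S}|S_i|\Big(\prod_{\ell\in S}\xi_\ell^{|S_\ell|}\Big)\Delta_S=c_i\Big(\sum_{S\in\mathcal{A}}\Big(\prod_{\ell\in S}\xi_\ell^{|S_\ell|}\Big)\Delta_S\Big)\ \forall i\in[n]\Big\}.$$ *)

theory Defs
  imports
    Complex_Main
    "HOL-Library.FuncSet"
    "HOL-Library.Extended_Real"
    "Jordan_Normal_Form.Determinant"
    "Jordan_Normal_Form.DL_Submatrix"
begin

(* Index sets are zero-based: [n] is {..<n}, and the columns of X i are indexed by {..<ds i}.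
   A tuple of matrices of varying widths is a function X :: nat => real mat together with
   the widths ds :: nat => nat; only the arguments i < n matter. *)

(* Type real mat has no global zero, hence no plain sum; this is the sum of d x d matrices. *)
definition mat_family_sum :: "nat \<Rightarrow> (nat \<Rightarrow> real mat) \<Rightarrow> nat set \<Rightarrow> real mat" where
  "mat_family_sum d F I = mat d d (\<lambda>(a, b). \<Sum>i\<in>I. F i $$ (a, b))"

definition pos_def_mat :: "nat \<Rightarrow> real mat \<Rightarrow> bool" where
  "pos_def_mat d A \<longleftrightarrow>
     A \<in> carrier_mat d d \<and> A\<^sup>T = A \<and>
     (\<forall>v \<in> carrier_vec d. v \<noteq> 0\<^sub>v d \<longrightarrow> v \<bullet> (A *\<^sub>v v) > 0)"

(* For positive definite Q, the unique positive definite B with B^2 = Q^(-1);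
   unspecified for other arguments. *)
definition inv_sqrt_mat :: "nat \<Rightarrow> real mat \<Rightarrow> real mat" where
  "inv_sqrt_mat d Q =
     (THE B. pos_def_mat d B \<and> inverts_mat (B * B) Q \<and> inverts_mat Q (B * B))"

definition frobenius_norm :: "real mat \<Rightarrow> real" where
  "frobenius_norm A = sqrt (\<Sum>i<dim_row A. \<Sum>j<dim_col A. (A $$ (i, j))\<^sup>2)"

definition mat_tuple :: "nat \<Rightarrow> nat \<Rightarrow> (nat \<Rightarrow> nat) \<Rightarrow> (nat \<Rightarrow> real mat) \<Rightarrow> bool" where
  "mat_tuple d n ds X \<longleftrightarrow> (\<forall>i<n. X i \<in> carrier_mat d (ds i))"

definition matrix_frame :: "nat \<Rightarrow> nat \<Rightarrow> (nat \<Rightarrow> nat) \<Rightarrow> (nat \<Rightarrow> real mat) \<Rightarrow> bool" where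
  "matrix_frame d n ds X \<longleftrightarrow>
     mat_tuple d n ds X \<and>
     pos_def_mat d (mat_family_sum d (\<lambda>i. X i * (X i)\<^sup>T) {..<n})"

definition radial_isotropic ::
  "nat \<Rightarrow> nat \<Rightarrow> (nat \<Rightarrow> nat) \<Rightarrow> (nat \<Rightarrow> real mat) \<Rightarrow> real vec \<Rightarrow> bool" where
  "radial_isotropic d n ds X c \<longleftrightarrow>
     mat_tuple d n ds X \<and>
     (\<forall>i<n. X i \<noteq> 0\<^sub>m d (ds i)) \<and>
     mat_family_sum d
       (\<lambda>i. (c $ i / (frobenius_norm (X i))\<^sup>2) \<cdot>\<^sub>m (X i * (X i)\<^sup>T)) {..<n} = 1\<^sub>m d"

definition transforms_into_RIF ::
  "nat \<Rightarrow> nat \<Rightarrow> (nat \<Rightarrow> nat) \<Rightarrow> (nat \<Rightarrow> real mat) \<Rightarrow> real vec \<Rightarrow> real mat \<Rightarrow> bool" where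
  "transforms_into_RIF d n ds X c A \<longleftrightarrow>
     A \<in> carrier_mat d d \<and> invertible_mat A \<and>
     radial_isotropic d n ds (\<lambda>i. A * X i) c"

definition frame_op :: "nat \<Rightarrow> nat \<Rightarrow> (nat \<Rightarrow> real mat) \<Rightarrow> real vec \<Rightarrow> real mat" where
  "frame_op d n X t = mat_family_sum d (\<lambda>i. exp (t $ i) \<cdot>\<^sub>m (X i * (X i)\<^sup>T)) {..<n}"

definition frame_potential :: "nat \<Rightarrow> nat \<Rightarrow> (nat \<Rightarrow> real mat) \<Rightarrow> real vec \<Rightarrow> real" where
  "frame_potential d n X t = ln (det (frame_op d n X t))"

definition frame_inf :: "nat \<Rightarrow> nat \<Rightarrow> (nat \<Rightarrow> real mat) \<Rightarrow> real vec \<Rightarrow> ereal" where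
  "frame_inf d n X c = (INF t \<in> carrier_vec n. ereal (frame_potential d n X t - t \<bullet> c))"

(* Families (S_i) indexed by I are extensional functions, so that each one is counted once. *)
definition selections :: "nat \<Rightarrow> nat \<Rightarrow> (nat \<Rightarrow> nat) \<Rightarrow> (nat set \<times> (nat \<Rightarrow> nat set)) set" where
  "selections d n ds =
     {(I, S). I \<noteq> {} \<and> I \<subseteq> {..<n} \<and>
        S \<in> (\<Pi>\<^sub>E i\<in>I. {T. T \<noteq> {} \<and> T \<subseteq> {..<ds i}}) \<and> (\<Sum>i\<in>I. card (S i)) = d}"

definition sel_det :: "nat \<Rightarrow> (nat \<Rightarrow> real mat) \<Rightarrow> nat set \<times> (nat \<Rightarrow> nat set) \<Rightarrow> real" where
  "sel_det d X = (\<lambda>(I, S).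
     det (mat_family_sum d
       (\<lambda>l. submatrix (X l) UNIV (S l) * (submatrix (X l) UNIV (S l))\<^sup>T) I))"

definition sel_monom :: "real vec \<Rightarrow> nat set \<times> (nat \<Rightarrow> nat set) \<Rightarrow> real" where
  "sel_monom \<xi> = (\<lambda>(I, S). \<Prod>l\<in>I. (\<xi> $ l) ^ card (S l))"

definition frame_variety ::
  "nat \<Rightarrow> nat \<Rightarrow> (nat \<Rightarrow> nat) \<Rightarrow> (nat \<Rightarrow> real mat) \<Rightarrow> real vec \<Rightarrow> real vec set" where
  "frame_variety d n ds X c =
     {\<xi> \<in> carrier_vec n. (\<forall>i<n. \<xi> $ i > 0) \<and>
        (\<forall>i<n.
          (\<Sum>S \<in> {S \<in> selections d n ds. i \<in> fst S}.
             real (card (snd S i)) * sel_monom \<xi> S * sel_det d X S)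
          = c $ i * (\<Sum>S \<in> selections d n ds. sel_monom \<xi> S * sel_det d X S))}"

end

(* By the Cauchy-Binet formula, det Q(t) is the sum over selections S of Delta_S * prod_l e^(t_l |S_l|)
   with all Delta_S >= 0. Hence Phi is a log-sum-exp function, so it is convex, and t0 minimises
   Phi(t) - <t, c> iff the gradient vanishes there; the critical point equations, cleared of the
   denominator det Q(t0), are the equations of the variety. Differentiating the determinant directly
   gives the i-th partial derivative of Phi as e^(t_i) * |A X_i|_F^2 with A = Q^(-1/2). At a critical
   point this equals c_i, so the sum of c_i A X_i X_i^T A / |A X_i|_F^2 is A Q A = I. *)
theory Submission
  imports
    Defs
    "Jordan_Normal_Form.Jordan_Normal_Form_Existence"
    "Jordan_Normal_Form.Jordan_Normal_Form_Uniqueness"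
begin

section \<open>Cauchy-Binet expansion over selections\<close>

text \<open>The Frobenius norm enters by computing one number twice. The exponential sum over
  selections gives the partial derivative of det Q as \<open>det_grad\<close>, the quantity in the
  equations of the variety; a direct computation with A gives the same derivative with a Frobenius
  norm; uniqueness of derivatives equates the two. Only derivatives along coordinate lines occur,
  and a single tangent inequality for exp takes the place of convexity theory. The costly object is
  A. \<open>inv_sqrt_mat\<close> is a definite description, so existence and uniqueness of the
  positive definite root both have to be shown. They rest on diagonalising a symmetric matrix
  through its real Jordan form, which yields an invertible but not necessarily orthogonal change of
  basis; symmetry of functions of Q therefore needs its own argument. Cauchy-Binet is stated for
  sums of rank-one matrices because X_i X_i^T is the sum over its columns and a selection is a set
  of d column positions (i, j). Its summands stay determinants of rank-one sums, the shape of
  \<open>sel_det\<close>.\<close>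

lemma det_sum_rank_one:
  fixes w :: "'j \<Rightarrow> 'a :: comm_ring_1" and u v :: "'j \<Rightarrow> nat \<Rightarrow> 'a"
  assumes J: "finite J"
  shows "det (mat d d (\<lambda>(a, b). \<Sum>j\<in>J. w j * u j a * v j b)) =
    (\<Sum>K | K \<subseteq> J \<and> card K = d.
       (\<Prod>j\<in>K. w j) * det (mat d d (\<lambda>(a, b). \<Sum>j\<in>K. u j a * v j b)))"
proof -
  let ?N = "{0..<d}"
  \<comment> \<open>Multilinearity in the rows: \<open>f\<close> picks one summand for each row
    \<open>a\<close>, whose row is the scalar \<open>u (f a) a\<close> times the vector
    \<open>v (f a)\<close>.\<close>
  define D where "D f = (\<Prod>a\<in>?N. u (f a) a) * det (mat d d (\<lambda>(a, b). v (f a) b))" for f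
  text \<open>Leibniz expansion with the sums multiplied out; grouping the injective choice functions by
    their image afterwards avoids any ordering of the subsets \<open>K\<close>.\<close>
  have expand: "det (mat d d (\<lambda>(a, b). \<Sum>j\<in>K. x j * u j a * v j b)) =
      (\<Sum>f\<in>?N \<rightarrow>\<^sub>E K. (\<Prod>a\<in>?N. x (f a)) * D f)" if K: "finite K" for K and x :: "'j \<Rightarrow> 'a"
  proof -
    have "det (mat d d (\<lambda>(a, b). \<Sum>j\<in>K. x j * u j a * v j b)) =
        (\<Sum>p | p permutes ?N. signof p * (\<Prod>a\<in>?N. \<Sum>j\<in>K. x j * u j a * v j (p a)))"
      unfolding det_def'[OF mat_carrier]
      by (intro sum.cong prod.cong arg_cong2[where f="(*)"] refl) (auto simp: permutes_in_image)
    also have "\<dots> = (\<Sum>p | p permutes ?N. \<Sum>f\<in>?N \<rightarrow>\<^sub>E K.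
        signof p * (\<Prod>a\<in>?N. x (f a) * u (f a) a * v (f a) (p a)))"
      by (subst prod_sum_PiE) (use K in \<open>auto simp: sum_distrib_left\<close>)
    also have "\<dots> = (\<Sum>f\<in>?N \<rightarrow>\<^sub>E K. (\<Prod>a\<in>?N. x (f a)) * ((\<Prod>a\<in>?N. u (f a) a) *
        (\<Sum>p | p permutes ?N. signof p * (\<Prod>a\<in>?N. v (f a) (p a)))))"
      by (subst sum.swap) (simp add: prod.distrib sum_distrib_left mult_ac)
    also have "\<dots> = (\<Sum>f\<in>?N \<rightarrow>\<^sub>E K. (\<Prod>a\<in>?N. x (f a)) * D f)"
      unfolding D_def det_def'[OF mat_carrier]
      by (intro sum.cong prod.cong arg_cong2[where f="(*)"] refl) (auto simp: permutes_in_image)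
    finally show ?thesis .
  qed
  have D0: "D f = 0" if "\<not> inj_on f ?N" for f
  proof -
    from that obtain i j where ij: "i < d" "j < d" "i \<noteq> j" "f i = f j"
      by (auto simp: inj_on_def)
    have "det (mat d d (\<lambda>(a, b). v (f a) b)) = 0"
      by (rule det_identical_rows[OF mat_carrier ij(3) ij(1) ij(2)])
         (use ij in \<open>auto intro!: eq_vecI\<close>)
    then show ?thesis by (simp add: D_def)
  qed
  let ?F = "{f \<in> ?N \<rightarrow>\<^sub>E J. inj_on f ?N}"
  let ?G = "\<lambda>f. (\<Prod>a\<in>?N. w (f a)) * D f"
  have finP: "finite (?N \<rightarrow>\<^sub>E J)" using J by (intro finite_PiE) auto
  have "det (mat d d (\<lambda>(a, b). \<Sum>j\<in>J. w j * u j a * v j b)) = (\<Sum>f\<in>?N \<rightarrow>\<^sub>E J. ?G f)"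
    by (rule expand[OF J])
  also have "\<dots> = (\<Sum>f\<in>?F. ?G f)"
    by (rule sum.mono_neutral_right[OF finP]) (auto simp: D0)
  also have "\<dots> = (\<Sum>K | K \<subseteq> J \<and> card K = d. \<Sum>f | f \<in> ?F \<and> f ` ?N = K. ?G f)"
    by (rule sum.group[symmetric]) (use J finP in \<open>auto simp: card_image\<close>)
  also have "\<dots> = (\<Sum>K | K \<subseteq> J \<and> card K = d.
       (\<Prod>j\<in>K. w j) * det (mat d d (\<lambda>(a, b). \<Sum>j\<in>K. u j a * v j b)))"
  proof (rule sum.cong[OF refl])
    fix K assume "K \<in> {K. K \<subseteq> J \<and> card K = d}"
    then have K: "K \<subseteq> J" and d: "d = card K" by auto
    have finK: "finite K" using finite_subset[OF K J] .
    let ?H = "{f. f \<in> ?F \<and> f ` ?N = K}"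
    have inj: "inj_on f ?N" if "f ` ?N = K" for f
      using that d by (simp add: eq_card_imp_inj_on)
    have img: "f ` ?N = K" if "f \<in> ?N \<rightarrow>\<^sub>E K" "inj_on f ?N" for f
      using that d finK by (metis PiE_iff card_image card_atLeastLessThan card_subset_eq diff_zero image_subsetI)
    \<comment> \<open>As \<open>K\<close> has exactly d elements, an injective choice into
      \<open>K\<close> is onto. The fibre over \<open>K\<close> is thus the injective part of the
      same expansion for \<open>K\<close> alone with unit weights, and it sums back to a
      determinant.\<close>
    have H: "?H = {f \<in> ?N \<rightarrow>\<^sub>E K. inj_on f ?N}"
      using K img by (auto simp: PiE_iff)
    have "(\<Sum>f\<in>?H. ?G f) = (\<Sum>f\<in>?H. (\<Prod>j\<in>K. w j) * D f)"
    proof (rule sum.cong[OF refl])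
      fix f assume "f \<in> ?H"
      then have "inj_on f ?N" "f ` ?N = K" by auto
      then have "(\<Prod>a\<in>?N. w (f a)) = (\<Prod>j\<in>K. w j)"
        by (metis (no_types, lifting) prod.reindex_cong)
      then show "?G f = (\<Prod>j\<in>K. w j) * D f" by simp
    qed
    also have "\<dots> = (\<Prod>j\<in>K. w j) * (\<Sum>f\<in>?N \<rightarrow>\<^sub>E K. D f)"
      unfolding H sum_distrib_left[symmetric]
      by (intro arg_cong2[where f="(*)"] refl sum.mono_neutral_left finite_PiE)
         (use finK in \<open>auto simp: D0\<close>)
    also have "(\<Sum>f\<in>?N \<rightarrow>\<^sub>E K. D f) = det (mat d d (\<lambda>(a, b). \<Sum>j\<in>K. u j a * v j b))"
      using expand[OF finK, of "\<lambda>_. 1"] by simp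
    finally show "(\<Sum>f\<in>?H. ?G f) =
       (\<Prod>j\<in>K. w j) * det (mat d d (\<lambda>(a, b). \<Sum>j\<in>K. u j a * v j b))" .
  qed
  finally show ?thesis .
qed

text \<open>Enumerating the d elements of \<open>K\<close> turns the sum into M M^T with M square,
  so the determinant is a square; the order of the enumeration affects only the sign of det
  M.\<close>

lemma det_gram_nonneg:
  fixes v :: "'j \<Rightarrow> nat \<Rightarrow> real"
  assumes "card K = d" "finite K"
  shows "0 \<le> det (mat d d (\<lambda>(a, b). \<Sum>j\<in>K. v j a * v j b))"
proof -
  obtain h where h: "bij_betw h {0..<d} K" using assms ex_bij_betw_nat_finite by blast
  define M where "M = mat d d (\<lambda>(a, i). v (h i) a)"
  have M: "M \<in> carrier_mat d d" by (simp add: M_def)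
  have "mat d d (\<lambda>(a, b). \<Sum>j\<in>K. v j a * v j b) = M * M\<^sup>T"
    by (rule eq_matI) (auto simp: M_def scalar_prod_def sum.reindex_bij_betw[OF h, symmetric])
  then have "det (mat d d (\<lambda>(a, b). \<Sum>j\<in>K. v j a * v j b)) = det M * det M"
    using M by (simp add: det_mult det_transpose)
  then show ?thesis by simp
qed

text \<open>A selection is a d-element set of column positions, grouped by block. Nonempty
  extensional components make the grouping unique, and \<open>0 < d\<close> keeps the index set
  \<open>I\<close> nonempty.\<close>

lemma bij_betw_selections:
  assumes "0 < d"
  shows "bij_betw (\<lambda>(I, S). Sigma I S) (selections d n ds)
    {K. K \<subseteq> Sigma {..<n} (\<lambda>i. {..<ds i}) \<and> card K = d}"
proof (rule bij_betwI[where g = "\<lambda>K. (fst ` K, \<lambda>i\<in>fst ` K. {j. (i, j) \<in> K})"])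
  show "(\<lambda>(I, S). Sigma I S) \<in>
     selections d n ds \<rightarrow> {K. K \<subseteq> Sigma {..<n} (\<lambda>i. {..<ds i}) \<and> card K = d}"
  proof (clarsimp simp: selections_def, intro conjI)
    fix I S assume I: "I \<subseteq> {..<n}" and S: "S \<in> (\<Pi>\<^sub>E i\<in>I. {T. T \<noteq> {} \<and> T \<subseteq> {..<ds i}})"
    show "Sigma I S \<subseteq> Sigma {..<n} (\<lambda>i. {..<ds i})" using I S by (auto simp: PiE_iff subset_iff)
    have "finite I" using I finite_subset by blast
    moreover have "\<forall>i\<in>I. finite (S i)" using S by (auto simp: PiE_iff intro: finite_subset)
    ultimately show "card (Sigma I S) = (\<Sum>i\<in>I. card (S i))" by (simp add: card_SigmaI)
  qed
next
  show "(\<lambda>K. (fst ` K, \<lambda>i\<in>fst ` K. {j. (i, j) \<in> K})) \<in>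
     {K. K \<subseteq> Sigma {..<n} (\<lambda>i. {..<ds i}) \<and> card K = d} \<rightarrow> selections d n ds"
  proof (clarify)
    fix K assume K: "K \<subseteq> Sigma {..<n} (\<lambda>i. {..<ds i})" and d: "d = card K"
    have fin: "finite K" using K by (rule finite_subset) auto
    have ne: "K \<noteq> {}" using assms d by auto
    have sig: "Sigma (fst ` K) (\<lambda>i. {j. (i, j) \<in> K}) = K" by force
    have fin2: "finite {j. (i, j) \<in> K}" for i
      by (rule finite_subset[of _ "snd ` K"]) (use fin in force)+
    have sum: "(\<Sum>i\<in>fst ` K. card {j. (i, j) \<in> K}) = card (Sigma (fst ` K) (\<lambda>i. {j. (i, j) \<in> K}))"
      using fin fin2 by (simp add: card_SigmaI)
    show "(fst ` K, \<lambda>i\<in>fst ` K. {j. (i, j) \<in> K}) \<in> selections (card K) n ds"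
    proof -
      have "fst ` K \<noteq> {}" "fst ` K \<subseteq> {..<n}" using ne K by auto
      moreover have "(\<lambda>i\<in>fst ` K. {j. (i, j) \<in> K}) \<in> (\<Pi>\<^sub>E i\<in>fst ` K. {T. T \<noteq> {} \<and> T \<subseteq> {..<ds i}})"
        unfolding restrict_PiE_iff
      proof
        fix i assume "i \<in> fst ` K"
        then obtain j where "(i, j) \<in> K" by auto
        then show "{j. (i, j) \<in> K} \<in> {T. T \<noteq> {} \<and> T \<subseteq> {..<ds i}}" using K by blast
      qed
      ultimately show ?thesis using sig sum by (simp add: selections_def)
    qed
  qed
next
  fix p assume "p \<in> selections d n ds"
  then obtain I S where p: "p = (I, S)" and S: "S \<in> (\<Pi>\<^sub>E i\<in>I. {T. T \<noteq> {} \<and> T \<subseteq> {..<ds i}})"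
    by (auto simp: selections_def)
  have f: "fst ` Sigma I S = I" using S by (force simp: PiE_iff)
  have "(\<lambda>i\<in>I. {j. (i, j) \<in> Sigma I S}) = S"
    using S by (intro ext) (auto simp: PiE_iff restrict_def extensional_def)
  then show "(fst ` (case p of (I, S) \<Rightarrow> Sigma I S),
      \<lambda>i\<in>fst ` (case p of (I, S) \<Rightarrow> Sigma I S). {j. (i, j) \<in> (case p of (I, S) \<Rightarrow> Sigma I S)}) = p"
    using f p by simp
next
  fix K :: "(nat \<times> nat) set"
  show "(case (fst ` K, \<lambda>i\<in>fst ` K. {j. (i, j) \<in> K}) of (I, S) \<Rightarrow> Sigma I S) = K"
    by (simp cong: Sigma_cong) force
qed

text \<open>\<open>submatrix\<close> renumbers its columns through \<open>pick\<close>; this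
  bijection, injective by strict monotonicity, lets sums run over the original column indices
  again.\<close>

lemma bij_betw_pick:
  assumes "finite J"
  shows "bij_betw (pick J) {..<card J} J"
proof -
  have inj: "inj_on (pick J) {..<card J}"
    by (rule inj_onI) (metis lessThan_iff linorder_neqE_nat nat_neq_iff pick_mono_le)
  have "pick J ` {..<card J} \<subseteq> J" using pick_in_set_le by auto
  then show ?thesis
    using inj assms by (simp add: bij_betw_def card_image card_subset_eq)
qed

lemma submatrix_mult_transpose_index:
  fixes A :: "'a :: comm_semiring_0 mat"
  assumes A: "A \<in> carrier_mat m k" and J: "J \<subseteq> {..<k}" and "a < m" "b < m"
  shows "(submatrix A UNIV J * (submatrix A UNIV J)\<^sup>T) $$ (a, b) = (\<Sum>j\<in>J. A $$ (a, j) * A $$ (b, j))"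
proof -
  have fin: "finite J" using J finite_subset by blast
  have c: "{j. j < k \<and> j \<in> J} = J" using J by auto
  have "(submatrix A UNIV J * (submatrix A UNIV J)\<^sup>T) $$ (a, b) =
      (\<Sum>j<card J. A $$ (a, pick J j) * A $$ (b, pick J j))"
    using assms by (auto simp: submatrix_def scalar_prod_def c pick_UNIV atLeast0LessThan)
  also have "\<dots> = (\<Sum>j\<in>J. A $$ (a, j) * A $$ (b, j))"
    by (rule sum.reindex_bij_betw[OF bij_betw_pick[OF fin]])
  finally show ?thesis .
qed

lemma selectionsD:
  assumes "(I, S) \<in> selections d n ds"
  shows "finite I" "\<And>i. i \<in> I \<Longrightarrow> i < n" "\<And>i. i \<in> I \<Longrightarrow> S i \<subseteq> {..<ds i}"
    "\<And>i. i \<in> I \<Longrightarrow> finite (S i)"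
proof -
  have I: "I \<subseteq> {..<n}" and S: "\<And>i. i \<in> I \<Longrightarrow> S i \<subseteq> {..<ds i}"
    using assms by (auto simp: selections_def PiE_iff)
  show "finite I" "\<And>i. i \<in> I \<Longrightarrow> i < n" using I finite_subset by auto
  show "\<And>i. i \<in> I \<Longrightarrow> S i \<subseteq> {..<ds i}" by (rule S)
  show "\<And>i. i \<in> I \<Longrightarrow> finite (S i)" using S finite_subset finite_lessThan by blast
qed

context
  fixes d n :: nat and ds :: "nat \<Rightarrow> nat" and X :: "nat \<Rightarrow> real mat"
  assumes X: "mat_tuple d n ds X"
begin

text \<open>Brings Delta_S into the form of the summands of \<open>det_sum_rank_one\<close>, indexed
  by the positions in \<open>Sigma I S\<close>.\<close>

lemma sel_det_eq_det_gram:
  assumes "(I, S) \<in> selections d n ds"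
  shows "sel_det d X (I, S) =
    det (mat d d (\<lambda>(a, b). \<Sum>(l, j)\<in>Sigma I S. X l $$ (a, j) * X l $$ (b, j)))"
proof -
  note sel = selectionsD[OF assms]
  have "mat_family_sum d (\<lambda>l. submatrix (X l) UNIV (S l) * (submatrix (X l) UNIV (S l))\<^sup>T) I =
      mat d d (\<lambda>(a, b). \<Sum>(l, j)\<in>Sigma I S. X l $$ (a, j) * X l $$ (b, j))"
    unfolding mat_family_sum_def
    by (intro cong_mat refl)
      (use sel X in \<open>auto simp: sum.Sigma[symmetric] mat_tuple_def intro!: sum.cong
         submatrix_mult_transpose_index[where k = "ds _"]\<close>)
  then show ?thesis by (simp add: sel_det_def)
qed

text \<open>\<open>Sigma I S\<close> has exactly d elements, so Delta_S is a square Gram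
  determinant. The sign is what allows the Delta_S to act as weights in the proof of
  minimality.\<close>

lemma sel_det_nonneg:
  assumes "s \<in> selections d n ds"
  shows "0 \<le> sel_det d X s"
proof -
  obtain I S where s: "s = (I, S)" by fastforce
  note sel = selectionsD[OF assms[unfolded s]]
  have "card (Sigma I S) = d"
    using assms s sel by (auto simp: selections_def card_SigmaI)
  then have "0 \<le> det (mat d d (\<lambda>(a, b). \<Sum>p\<in>Sigma I S.
      (case p of (l, j) \<Rightarrow> \<lambda>a. X l $$ (a, j)) a * (case p of (l, j) \<Rightarrow> \<lambda>a. X l $$ (a, j)) b))"
    by (intro det_gram_nonneg) (use sel in auto)
  then show ?thesis unfolding s sel_det_eq_det_gram[OF assms[unfolded s]]
    by (simp add: case_prod_beta)
qed

text \<open>Every column of \<open>X l\<close> carries the weight \<open>\<xi> $ l\<close>, so a set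
  of positions with |S_l| columns in block l collects that weight to the power |S_l|.\<close>

lemma det_weighted_frame_sum:
  assumes "0 < d"
  shows "det (mat_family_sum d (\<lambda>i. \<xi> $ i \<cdot>\<^sub>m (X i * (X i)\<^sup>T)) {..<n}) =
    (\<Sum>s\<in>selections d n ds. sel_monom \<xi> s * sel_det d X s)"
proof -
  let ?J = "Sigma {..<n} (\<lambda>i. {..<ds i})"
  let ?v = "\<lambda>p a. X (fst p) $$ (a, snd p)"
  have "mat_family_sum d (\<lambda>i. \<xi> $ i \<cdot>\<^sub>m (X i * (X i)\<^sup>T)) {..<n} =
      mat d d (\<lambda>(a, b). \<Sum>p\<in>?J. \<xi> $ fst p * ?v p a * ?v p b)"
    unfolding mat_family_sum_def
  proof (intro cong_mat refl, clarsimp)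
    fix a b assume ab: "a < d" "b < d"
    have "(\<Sum>i<n. (\<xi> $ i \<cdot>\<^sub>m (X i * (X i)\<^sup>T)) $$ (a, b)) =
        (\<Sum>i<n. \<Sum>j<ds i. \<xi> $ i * X i $$ (a, j) * X i $$ (b, j))"
      using ab X by (intro sum.cong refl)
        (auto simp: mat_tuple_def scalar_prod_def sum_distrib_left atLeast0LessThan mult_ac carrier_matD)
    also have "\<dots> = (\<Sum>p\<in>?J. \<xi> $ fst p * ?v p a * ?v p b)"
      by (subst sum.Sigma) (auto simp: case_prod_beta)
    finally show "(\<Sum>i<n. (\<xi> $ i \<cdot>\<^sub>m (X i * (X i)\<^sup>T)) $$ (a, b)) =
      (\<Sum>p\<in>?J. \<xi> $ fst p * ?v p a * ?v p b)" .
  qed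
  then have "det (mat_family_sum d (\<lambda>i. \<xi> $ i \<cdot>\<^sub>m (X i * (X i)\<^sup>T)) {..<n}) =
     (\<Sum>K | K \<subseteq> ?J \<and> card K = d. (\<Prod>p\<in>K. \<xi> $ fst p) *
        det (mat d d (\<lambda>(a, b). \<Sum>p\<in>K. ?v p a * ?v p b)))"
    by (simp add: det_sum_rank_one)
  also have "\<dots> = (\<Sum>s\<in>selections d n ds. sel_monom \<xi> s * sel_det d X s)"
  proof (subst sum.reindex_bij_betw[OF bij_betw_selections[OF assms], symmetric], rule sum.cong[OF refl])
    fix s assume s: "s \<in> selections d n ds"
    obtain I S where IS: "s = (I, S)" by fastforce
    note sel = selectionsD[OF s[unfolded IS]]
    have "(\<Prod>p\<in>Sigma I S. \<xi> $ fst p) = (\<Prod>l\<in>I. \<Prod>j\<in>S l. \<xi> $ l)"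
      using sel by (subst prod.Sigma) (auto simp: case_prod_beta)
    then have "(\<Prod>p\<in>Sigma I S. \<xi> $ fst p) = sel_monom \<xi> s"
      by (simp add: IS sel_monom_def)
    then show "(\<Prod>p\<in>(case s of (I, S) \<Rightarrow> Sigma I S). \<xi> $ fst p) *
        det (mat d d (\<lambda>(a, b). \<Sum>p\<in>(case s of (I, S) \<Rightarrow> Sigma I S). ?v p a * ?v p b)) =
        sel_monom \<xi> s * sel_det d X s"
      using sel_det_eq_det_gram[OF s[unfolded IS]] by (simp add: IS case_prod_beta)
  qed
  finally show ?thesis .
qed

end

section \<open>Inverse square roots of positive definite matrices\<close>

lemma symmetric_mat_complex_eigenvalue_real:
  fixes A :: "real mat" and z :: complex
  assumes A: "A \<in> carrier_mat n n" and sym: "A\<^sup>T = A"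
    and ev: "eigenvalue (map_mat of_real A) z"
  shows "Im z = 0"
proof -
  obtain v where v: "v \<in> carrier_vec n" "v \<noteq> 0\<^sub>v n" "map_mat of_real A *\<^sub>v v = z \<cdot>\<^sub>v v"
    using ev A by (auto simp: eigenvalue_def eigenvector_def)
  have Aij: "A $$ (i, j) = A $$ (j, i)" if "i < n" "j < n" for i j
    using A sym that by (metis carrier_matD index_transpose_mat(1))
  have eq: "(\<Sum>j<n. of_real (A $$ (i, j)) * v $ j) = z * v $ i" if "i < n" for i
  proof -
    have "dim_row A = n" "dim_col A = n" "dim_vec v = n" using A v by auto
    moreover from this have "(map_mat of_real A *\<^sub>v v) $ i = z * v $ i" using v(3) that by simp
    ultimately show ?thesis using that by (simp add: scalar_prod_def atLeast0LessThan)
  qed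
  have re: "(\<Sum>j<n. A $$ (i, j) * Re (v $ j)) = Re z * Re (v $ i) - Im z * Im (v $ i)" if "i < n" for i
    using arg_cong[OF eq[OF that], of Re] by simp
  have im: "(\<Sum>j<n. A $$ (i, j) * Im (v $ j)) = Re z * Im (v $ i) + Im z * Re (v $ i)" if "i < n" for i
    using arg_cong[OF eq[OF that], of Im] by simp
  \<comment> \<open>Write v = x + iy and z = p + iq, so that Ax = px - qy and Ay = py + qx. Symmetry
    gives y . Ax = x . Ay, that is q (|x|^2 + |y|^2) = 0.\<close>
  have "(\<Sum>i<n. \<Sum>j<n. Im (v $ i) * (A $$ (i, j) * Re (v $ j))) =
      (\<Sum>i<n. \<Sum>j<n. Re (v $ i) * (A $$ (i, j) * Im (v $ j)))"
    by (subst sum.swap) (auto intro!: sum.cong simp: Aij)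
  then have "(\<Sum>i<n. Im (v $ i) * (Re z * Re (v $ i) - Im z * Im (v $ i))) =
      (\<Sum>i<n. Re (v $ i) * (Re z * Im (v $ i) + Im z * Re (v $ i)))"
    by (simp add: sum_distrib_left[symmetric] re im)
  then have "(\<Sum>i<n. Re (v $ i) * (Re z * Im (v $ i) + Im z * Re (v $ i))
      - Im (v $ i) * (Re z * Re (v $ i) - Im z * Im (v $ i))) = 0"
    by (simp add: sum_subtractf)
  then have "Im z * (\<Sum>i<n. (Re (v $ i))\<^sup>2 + (Im (v $ i))\<^sup>2) = 0"
    by (simp add: sum_distrib_left algebra_simps power2_eq_square)
  moreover have "(\<Sum>i<n. (Re (v $ i))\<^sup>2 + (Im (v $ i))\<^sup>2) \<noteq> 0"
  proof
    assume "(\<Sum>i<n. (Re (v $ i))\<^sup>2 + (Im (v $ i))\<^sup>2) = 0"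
    then have "\<forall>i<n. (Re (v $ i))\<^sup>2 + (Im (v $ i))\<^sup>2 = 0"
      by (subst (asm) sum_nonneg_eq_0_iff) auto
    then have "\<forall>i<n. v $ i = 0" by (simp add: complex_eq_iff sum_power2_eq_zero_iff)
    then show False using v by (auto intro!: eq_vecI)
  qed
  ultimately show ?thesis by simp
qed

text \<open>The polynomial splits over the complex numbers with real roots only, and the embedding
  of real polynomials is injective. Splitting over the reals is the condition for a real Jordan
  form.\<close>

lemma symmetric_mat_char_poly_splits:
  fixes A :: "real mat"
  assumes A: "A \<in> carrier_mat n n" and sym: "A\<^sup>T = A"
  shows "\<exists>es. char_poly A = (\<Prod>e\<leftarrow>es. [:- e, 1:])"
proof -
  let ?C = "map_mat complex_of_real A"
  interpret h: map_poly_inj_idom_hom complex_of_real ..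
  have C: "?C \<in> carrier_mat n n" using A by simp
  obtain as where as: "char_poly ?C = (\<Prod>a\<leftarrow>as. [:- a, 1:])"
    using char_poly_factorized[OF C] by blast
  have "Im a = 0" if "a \<in> set as" for a
  proof -
    have "poly (char_poly ?C) a = 0" using that by (auto simp: as poly_prod_list prod_list_zero_iff)
    then show ?thesis
      using symmetric_mat_complex_eigenvalue_real[OF A sym] eigenvalue_root_char_poly[OF C] by blast
  qed
  then have "map (complex_of_real \<circ> Re) as = as"
    by (intro map_idI) (simp add: complex_eq_iff)
  moreover have "map_poly complex_of_real (\<Prod>a\<leftarrow>as. [:- Re a, 1:]) =
      (\<Prod>a\<leftarrow>map (complex_of_real \<circ> Re) as. [:- a, 1:])"
    by (simp add: h.hom_prod_list o_def del: h.prod_list_map_hom)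
  ultimately have "map_poly complex_of_real (char_poly A) =
      map_poly complex_of_real (\<Prod>e\<leftarrow>map Re as. [:- e, 1:])"
    by (simp add: of_real_hom.char_poly_hom[OF A, symmetric] as o_def)
  then have "char_poly A = (\<Prod>e\<leftarrow>map Re as. [:- e, 1:])" by (rule h.injectivity)
  then show ?thesis by blast
qed

lemma scalar_prod_self_pos:
  fixes v :: "real vec"
  assumes "v \<in> carrier_vec n" "v \<noteq> 0\<^sub>v n"
  shows "0 < v \<bullet> v"
  using assms conjugate_square_greater_0_vec[of v n] by simp

text \<open>By symmetry |Bv|^2 = v . B(Bv), so B(Bv) = 0 already forces Bv = 0.\<close>

lemma symmetric_mult_self_vec_eq_0_iff:
  fixes B :: "real mat"
  assumes B: "B \<in> carrier_mat n n" "B\<^sup>T = B" and v: "v \<in> carrier_vec n"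
  shows "B *\<^sub>v (B *\<^sub>v v) = 0\<^sub>v n \<longleftrightarrow> B *\<^sub>v v = 0\<^sub>v n"
proof
  assume "B *\<^sub>v (B *\<^sub>v v) = 0\<^sub>v n"
  then have "(B *\<^sub>v v) \<bullet> (B *\<^sub>v v) = 0"
    using transpose_vec_mult_scalar[of B n n v "B *\<^sub>v v"] B v by simp
  then show "B *\<^sub>v v = 0\<^sub>v n"
    using B v scalar_prod_self_pos[of "B *\<^sub>v v" n] by force
qed (use B in \<open>auto intro!: eq_vecI\<close>)

lemma diagonal_jordan_matrix:
  assumes "\<forall>(k, e)\<in>set n_as. k \<le> 1"
  shows "diagonal_mat (jordan_matrix n_as)"
  using assms
proof (induction n_as)
  case Nil
  show ?case by (simp add: diagonal_mat_def)
next
  case (Cons p n_as)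
  obtain k e where p: "p = (k, e)" by fastforce
  show ?case
    using Cons by (auto simp: p jordan_matrix_Cons diagonal_mat_def)
qed

lemma symmetric_mat_diagonalizable:
  fixes A :: "real mat"
  assumes A: "A \<in> carrier_mat n n" and sym: "A\<^sup>T = A"
  obtains D P Q where "similar_mat_wit A D P Q" "diagonal_mat D"
proof -
  obtain n_as where jnf: "jordan_nf A n_as"
    using symmetric_mat_char_poly_splits[OF A sym] jordan_nf_exists[OF A] by blast
  text \<open>For symmetric \<open>B\<close>, \<open>B\<^sup>2\<close> and \<open>B\<close> have the same kernel, which rules out larger Jordan blocks.\<close>
  have small: "k \<le> 1" if "(k, e) \<in> set n_as" for k e
  proof -
    let ?B = "char_matrix A e"
    let ?ns = "map fst [(k, a)\<leftarrow>n_as . a = e]"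
    have B: "?B \<in> carrier_mat n n" using A by simp
    have Bs: "?B\<^sup>T = ?B" using A sym by (auto simp: char_matrix_def transpose_add)
    have "mat_kernel (?B ^\<^sub>m 2) = mat_kernel (?B ^\<^sub>m 1)"
      using B symmetric_mult_self_vec_eq_0_iff[OF B Bs]
      by (auto simp: mat_kernel[of _ n n] numeral_2_eq_2)
    then have "dim_gen_eigenspace A e 2 = dim_gen_eigenspace A e 1"
      using B by (simp add: dim_gen_eigenspace_def kernel_dim_def numeral_2_eq_2)
    \<comment> \<open>A Jordan block of size k for \<open>e\<close> contributes min m k to the
      dimension of the kernel of the m-th power of \<open>?B\<close>. Equality for m = 1 and m = 2
      excludes k > 1, since each summand can only grow.\<close>
    then have eq: "(\<Sum>k\<leftarrow>?ns. min 2 k) = (\<Sum>k\<leftarrow>?ns. min 1 k)"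
      by (simp add: dim_gen_eigenspace[OF jnf])
    have aux: "(\<forall>k\<in>set ks. k \<le> 1) \<or> (\<Sum>k\<leftarrow>ks. min 1 k) < (\<Sum>k\<leftarrow>ks. min 2 k)" for ks :: "nat list"
    proof (induction ks)
      case (Cons k ks)
      have "(\<Sum>k\<leftarrow>ks. min 1 k) \<le> (\<Sum>k\<leftarrow>ks. min 2 k)" by (rule sum_list_mono) simp
      then show ?case using Cons by (cases "k \<le> 1") auto
    qed simp
    show ?thesis using aux[of ?ns] eq that by force
  qed
  obtain P Q where "similar_mat_wit A (jordan_matrix n_as) P Q"
    using jnf by (auto simp: jordan_nf_def similar_mat_def)
  moreover have "diagonal_mat (jordan_matrix n_as)"
    by (rule diagonal_jordan_matrix) (use small in auto)
  ultimately show ?thesis by (rule that)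
qed

lemma diagonal_similarity_eigenvector:
  fixes A :: "'a :: field mat"
  assumes A: "A \<in> carrier_mat n n" and w: "similar_mat_wit A D P Q" and D: "diagonal_mat D"
    and i: "i < n"
  shows "eigenvector A (col P i) (D $$ (i, i))"
proof -
  note W = similar_mat_witD2[OF A w]
  have "A * P = P * D"
    using W assoc_mult_mat[of "P * D" n n Q n P n] by simp
  then have "A *\<^sub>v col P i = col (P * D) i" using W i by (metis col_mult2)
  also have "\<dots> = D $$ (i, i) \<cdot>\<^sub>v col P i"
  proof (rule eq_vecI)
    fix k assume "k < dim_vec (D $$ (i, i) \<cdot>\<^sub>v col P i)"
    then have k: "k < n" using W by simp
    have "(\<Sum>j<n. P $$ (k, j) * D $$ (j, i)) = (\<Sum>j<n. if j = i then D $$ (i, i) * P $$ (k, i) else 0)"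
      using D W i by (intro sum.cong) (auto simp: diagonal_mat_def)
    also have "\<dots> = D $$ (i, i) * P $$ (k, i)" using i by simp
    finally show "col (P * D) i $ k = (D $$ (i, i) \<cdot>\<^sub>v col P i) $ k"
      using W i k by (simp add: scalar_prod_def atLeast0LessThan)
  qed (use W in simp)
  finally have "A *\<^sub>v col P i = D $$ (i, i) \<cdot>\<^sub>v col P i" .
  \<comment> \<open>\<open>Q\<close> is the inverse of \<open>P\<close>, so it sends this column to
    a unit vector.\<close>
  moreover have "col P i \<noteq> 0\<^sub>v n"
  proof
    assume "col P i = 0\<^sub>v n"
    moreover have "col (Q * P) i = Q *\<^sub>v col P i" using W i by (metis col_mult2)
    moreover have "Q *\<^sub>v 0\<^sub>v n = 0\<^sub>v n" using W by (auto intro!: eq_vecI)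
    ultimately have "unit_vec n i = (0\<^sub>v n :: 'a vec)" using W i by simp
    then have "unit_vec n i $ i = (0 :: 'a)" using i by simp
    then show False using i by simp
  qed
  ultimately show ?thesis using W i A by (simp add: eigenvector_def)
qed

text \<open>For an eigenvector v of the symmetric matrix B - C with eigenvalue e, 0 = |Bv|^2 -
  |Cv|^2 = (Bv - Cv) . (Bv + Cv) = e (v . Bv + v . Cv), and the bracket is positive. All eigenvalues
  of B - C vanish, so diagonalisability gives B = C.\<close>

lemma pos_def_sqrt_unique:
  assumes B: "pos_def_mat d B" and C: "pos_def_mat d C" and eq: "B * B = C * C"
  shows "B = C"
proof -
  have Bc: "B \<in> carrier_mat d d" "B\<^sup>T = B" and Cc: "C \<in> carrier_mat d d" "C\<^sup>T = C"
    using B C by (auto simp: pos_def_mat_def)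
  define Z where "Z = B - C"
  have Z: "Z \<in> carrier_mat d d" unfolding Z_def by (rule minus_carrier_mat[OF Cc(1)])
  have Zs: "Z\<^sup>T = Z" using Bc Cc by (simp add: Z_def transpose_minus)
  obtain D P Q where w: "similar_mat_wit Z D P Q" and D: "diagonal_mat D"
    using symmetric_mat_diagonalizable[OF Z Zs] by blast
  note W = similar_mat_witD2[OF Z w]
  have "D $$ (i, i) = 0" if i: "i < d" for i
  proof -
    let ?e = "D $$ (i, i)"
    obtain v where v: "v \<in> carrier_vec d" "v \<noteq> 0\<^sub>v d" "Z *\<^sub>v v = ?e \<cdot>\<^sub>v v"
      using diagonal_similarity_eigenvector[OF Z w D i] Z by (auto simp: eigenvector_def)
    have diff: "B *\<^sub>v v - C *\<^sub>v v = ?e \<cdot>\<^sub>v v"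
      using v Bc Cc by (simp add: Z_def minus_mult_distrib_mat_vec)
    have "0 = v \<bullet> (B *\<^sub>v (B *\<^sub>v v)) - v \<bullet> (C *\<^sub>v (C *\<^sub>v v))"
      using eq Bc Cc v by (metis assoc_mult_mat_vec cancel_comm_monoid_add_class.diff_cancel)
    also have "\<dots> = (B *\<^sub>v v) \<bullet> (B *\<^sub>v v) - (C *\<^sub>v v) \<bullet> (C *\<^sub>v v)"
      using transpose_vec_mult_scalar[of B d d "B *\<^sub>v v" v] transpose_vec_mult_scalar[of C d d "C *\<^sub>v v" v]
        Bc Cc v by (simp add: comm_scalar_prod[of v d])
    also have "\<dots> = (B *\<^sub>v v - C *\<^sub>v v) \<bullet> (B *\<^sub>v v) + (B *\<^sub>v v - C *\<^sub>v v) \<bullet> (C *\<^sub>v v)"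
      using Bc Cc v
      by (simp add: minus_scalar_prod_distrib[of _ d] comm_scalar_prod[of "C *\<^sub>v v" d "B *\<^sub>v v"])
    also have "\<dots> = ?e * (v \<bullet> (B *\<^sub>v v) + v \<bullet> (C *\<^sub>v v))"
      using Bc Cc v by (simp add: diff distrib_left)
    finally have "?e * (v \<bullet> (B *\<^sub>v v) + v \<bullet> (C *\<^sub>v v)) = 0" by simp
    moreover have "0 < v \<bullet> (B *\<^sub>v v)" "0 < v \<bullet> (C *\<^sub>v v)"
      using B C v by (auto simp: pos_def_mat_def)
    ultimately show ?thesis by auto
  qed
  then have "D = 0\<^sub>m d d" using D W by (intro eq_matI) (auto simp: diagonal_mat_def)
  then have "Z = 0\<^sub>m d d" using W by simp
  then show ?thesis
    using Bc Cc unfolding Z_def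
    by (intro eq_matI) (auto simp: mat_eq_iff)
qed

lemma pos_def_inv_sqrt_exists:
  assumes Q: "pos_def_mat d Q"
  shows "\<exists>B. pos_def_mat d B \<and> inverts_mat (B * B) Q \<and> inverts_mat Q (B * B)"
proof -
  have A: "Q \<in> carrier_mat d d" and sym: "Q\<^sup>T = Q" using Q by (auto simp: pos_def_mat_def)
  obtain D P R where w: "similar_mat_wit Q D P R" and D: "diagonal_mat D"
    using symmetric_mat_diagonalizable[OF A sym] by blast
  note W = similar_mat_witD2[OF A w]
  have pos: "0 < D $$ (i, i)" if i: "i < d" for i
  proof -
    let ?v = "col P i"
    have v: "?v \<in> carrier_vec d" "?v \<noteq> 0\<^sub>v d" "Q *\<^sub>v ?v = D $$ (i, i) \<cdot>\<^sub>v ?v"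
      using diagonal_similarity_eigenvector[OF A w D i] A W by (auto simp: eigenvector_def)
    have "0 < ?v \<bullet> (Q *\<^sub>v ?v)" using Q v(1,2) unfolding pos_def_mat_def by blast
    also have "\<dots> = D $$ (i, i) * (?v \<bullet> ?v)" using v by simp
    finally show ?thesis using scalar_prod_self_pos[OF v(1,2)] by (simp add: zero_less_mult_iff)
  qed
  \<comment> \<open>Functional calculus: \<open>F f\<close> stands for f(Q). It is multiplicative in
    \<open>f\<close> and sees \<open>f\<close> only at the eigenvalues, which are positive;
    identities valid on positive reals therefore transfer to matrices.\<close>
  define diag where "diag f = mat d d (\<lambda>(i, j). if i = j then f (D $$ (i, i)) else 0)" for f :: "real \<Rightarrow> real"
  define F where "F f = P * diag f * R" for f
  have dg: "diag f \<in> carrier_mat d d" for f by (simp add: diag_def)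
  have F: "F f \<in> carrier_mat d d" for f using W dg[of f] by (simp add: F_def)
  have diag_mult_left: "(diag f * M) $$ (i, j) = f (D $$ (i, i)) * M $$ (i, j)"
    if "M \<in> carrier_mat d d" "i < d" "j < d" for f M i j
  proof -
    have "(diag f * M) $$ (i, j) = (\<Sum>k<d. (if i = k then f (D $$ (i, i)) else 0) * M $$ (k, j))"
      using that by (simp add: diag_def scalar_prod_def atLeast0LessThan)
    also have "\<dots> = (\<Sum>k<d. if k = i then f (D $$ (i, i)) * M $$ (i, j) else 0)"
      by (rule sum.cong) auto
    finally show ?thesis using that by simp
  qed
  have diag_mult_right: "(M * diag f) $$ (i, j) = M $$ (i, j) * f (D $$ (j, j))"
    if "M \<in> carrier_mat d d" "i < d" "j < d" for f M i j
  proof -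
    have "(M * diag f) $$ (i, j) = (\<Sum>k<d. M $$ (i, k) * (if k = j then f (D $$ (k, k)) else 0))"
      using that by (simp add: diag_def scalar_prod_def atLeast0LessThan)
    also have "\<dots> = (\<Sum>k<d. if k = j then M $$ (i, j) * f (D $$ (j, j)) else 0)"
      by (rule sum.cong) auto
    finally show ?thesis using that by simp
  qed
  have diag_mult: "diag f * diag g = diag (\<lambda>x. f x * g x)" for f g
  proof (rule eq_matI)
    show "(diag f * diag g) $$ (i, j) = diag (\<lambda>x. f x * g x) $$ (i, j)"
      if "i < dim_row (diag (\<lambda>x. f x * g x))" "j < dim_col (diag (\<lambda>x. f x * g x))" for i j
    proof -
      have ij: "i < d" "j < d" using that by (auto simp: diag_def)
      show ?thesis unfolding diag_mult_left[OF dg ij] using ij by (simp add: diag_def)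
    qed
  qed (simp_all add: diag_def)
  have diag_cong: "diag f = diag g" if "\<And>x. 0 < x \<Longrightarrow> f x = g x" for f g
    using that pos by (auto simp: diag_def)
  have F_mult: "F f * F g = F (\<lambda>x. f x * g x)" for f g
  proof -
    have "F f * F g = P * diag f * (R * P) * diag g * R"
      using W(4-7) dg[of f] dg[of g] by (simp add: F_def assoc_mult_mat[of _ d d _ d _ d])
    also have "\<dots> = P * (diag f * diag g) * R"
      using W(2,4-7) dg[of f] dg[of g] assoc_mult_mat[of P d d "diag f" d "diag g" d] by simp
    finally show ?thesis by (simp add: diag_mult F_def)
  qed
  have "diag (\<lambda>x. x) = D" using D W by (intro eq_matI) (auto simp: diag_def diagonal_mat_def)
  then have F_id: "F (\<lambda>x. x) = Q" using W by (simp add: F_def)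
  have "diag (\<lambda>x. 1) = 1\<^sub>m d" by (auto simp: diag_def)
  then have F_one: "F (\<lambda>x. 1) = 1\<^sub>m d" using W by (simp add: F_def)
  have F_cong: "F f = F g" if "\<And>x. 0 < x \<Longrightarrow> f x = g x" for f g
    using diag_cong[OF that] by (simp add: F_def)
  text \<open>\<open>P\<close> need not be orthogonal. Symmetry of \<open>F f\<close> amounts to \<open>P\<^sup>T P\<close> commuting with \<open>diag f\<close>;
    for \<open>f = id\<close> this is the symmetry of \<open>Q\<close>, and the general case follows entrywise.\<close>
  let ?G = "P\<^sup>T * P"
  have G: "?G \<in> carrier_mat d d" using W by simp
  have conj: "P\<^sup>T * F f * P = ?G * diag f" for f
  proof -
    have "P\<^sup>T * F f * P = ?G * diag f * (R * P)"
      using W dg[of f] by (simp add: F_def assoc_mult_mat[of _ d d _ d _ d])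
    then show ?thesis using W dg[of f] G by simp
  qed
  have conjT: "P\<^sup>T * M\<^sup>T * P = (P\<^sup>T * M * P)\<^sup>T" if "M \<in> carrier_mat d d" for M :: "real mat"
    using W that by (simp add: transpose_mult[of _ d d _ d] assoc_mult_mat[of _ d d _ d _ d])
  have GT: "(?G * diag f)\<^sup>T = diag f * ?G" for f
  proof -
    have "(diag f)\<^sup>T = diag f" by (rule eq_matI) (auto simp: diag_def)
    then show ?thesis using W dg[of f] G by (simp add: transpose_mult[of _ d d _ d])
  qed
  have Gcomm: "?G * diag f = diag f * ?G" for f
  proof (rule eq_matI)
    have "?G * diag (\<lambda>x. x) = diag (\<lambda>x. x) * ?G"
      using conj[of "\<lambda>x. x"] conjT[OF A] sym GT by (metis F_id)
    then have "?G $$ (i, j) * D $$ (j, j) = D $$ (i, i) * ?G $$ (i, j)" if "i < d" "j < d" for i j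
      using that G diag_mult_left[OF G that, of "\<lambda>x. x"] diag_mult_right[OF G that, of "\<lambda>x. x"]
      by auto
    \<comment> \<open>An entry of P^T P vanishes or links two equal eigenvalues, and on equal
      eigenvalues every \<open>f\<close> agrees.\<close>
    then have dis: "?G $$ (i, j) = 0 \<or> D $$ (j, j) = D $$ (i, i)" if "i < d" "j < d" for i j
      using that by (metis mult.commute mult_cancel_left)
    show "(?G * diag f) $$ (i, j) = (diag f * ?G) $$ (i, j)"
      if "i < dim_row (diag f * ?G)" "j < dim_col (diag f * ?G)" for i j
    proof -
      have ij: "i < d" "j < d" using that W dg[of f] by auto
      show ?thesis
        unfolding diag_mult_left[OF G ij] diag_mult_right[OF G ij] using dis[OF ij] by auto
    qed
  qed (use W dg[of f] in auto)
  have F_sym: "(F f)\<^sup>T = F f" for f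
  proof -
    have eq: "P\<^sup>T * (F f)\<^sup>T * P = P\<^sup>T * F f * P"
      unfolding conjT[OF F] unfolding conj GT by (rule Gcomm[symmetric])
    have RP: "R\<^sup>T * P\<^sup>T = 1\<^sub>m d" using W transpose_mult[of P d d R d] by simp
    have "M = R\<^sup>T * (P\<^sup>T * M * P) * R" if M: "M \<in> carrier_mat d d" for M
    proof -
      have "R\<^sup>T * (P\<^sup>T * M * P) * R = (R\<^sup>T * P\<^sup>T) * M * (P * R)"
        using W M by (simp add: assoc_mult_mat[of _ d d _ d _ d])
      then show ?thesis using M W RP by simp
    qed
    then show ?thesis using eq F by (metis transpose_carrier_mat)
  qed
  \<comment> \<open>The matrix is the square of the symmetric matrix \<open>F f\<close>, so its
    quadratic form at v is |F f v|^2; the functional calculus inverts \<open>F f\<close>, hence this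
    is nonzero.\<close>
  have F_pos: "pos_def_mat d (F (\<lambda>x. f x * f x))" if f: "\<And>x. 0 < x \<Longrightarrow> f x \<noteq> 0" for f
  proof -
    have "0 < v \<bullet> (F (\<lambda>x. f x * f x) *\<^sub>v v)" if v: "v \<in> carrier_vec d" "v \<noteq> 0\<^sub>v d" for v
    proof -
      have "F (\<lambda>x. inverse (f x)) * F f = 1\<^sub>m d"
        unfolding F_mult F_one[symmetric] by (rule F_cong) (use f in simp)
      then have "F f *\<^sub>v v \<noteq> 0\<^sub>v d"
        using v F[of f] F[of "\<lambda>x. inverse (f x)"] assoc_mult_mat_vec[of "F (\<lambda>x. inverse (f x))" d d "F f" d v]
        by (auto intro!: eq_vecI)
      then have "0 < (F f *\<^sub>v v) \<bullet> (F f *\<^sub>v v)"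
        using F v by (intro scalar_prod_self_pos[of _ d]) (auto intro: mult_mat_vec_carrier)
      also have "\<dots> = v \<bullet> (F f *\<^sub>v (F f *\<^sub>v v))"
        using transpose_vec_mult_scalar[of "F f" d d "F f *\<^sub>v v" v] F[of f] v F_sym
          comm_scalar_prod[of v d "F f *\<^sub>v (F f *\<^sub>v v)"]
        by (metis mult_mat_vec_carrier comm_scalar_prod)
      also have "\<dots> = v \<bullet> (F (\<lambda>x. f x * f x) *\<^sub>v v)"
        unfolding F_mult[symmetric] assoc_mult_mat_vec[OF F F v(1)] ..
      finally show ?thesis .
    qed
    then show ?thesis using F F_sym by (simp add: pos_def_mat_def)
  qed
  \<comment> \<open>The fourth root appears because \<open>F_pos\<close> wants the function as a
    square: x^(-1/2) is the square of x^(-1/4).\<close>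
  let ?s = "\<lambda>x. sqrt (sqrt (inverse x))"
  let ?B = "F (\<lambda>x. ?s x * ?s x)"
  have "pos_def_mat d ?B" by (rule F_pos) simp
  moreover have BB: "?B * ?B = F inverse"
    unfolding F_mult by (rule F_cong) simp
  moreover have "F inverse * Q = 1\<^sub>m d"
    unfolding F_id[symmetric] F_mult F_one[symmetric] by (rule F_cong) simp
  moreover have "Q * F inverse = 1\<^sub>m d"
    unfolding F_id[symmetric] F_mult F_one[symmetric] by (rule F_cong) simp
  ultimately show ?thesis using F[of inverse] A
    by (intro exI[of _ ?B]) (simp add: inverts_mat_def)
qed

text \<open>Unfolding the definite description needs a unique candidate. For two candidates B and C,
  the squares are a left and a right inverse of Q, hence equal, and
  \<open>pos_def_sqrt_unique\<close> applies.\<close>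

lemma inv_sqrt_mat:
  assumes Q: "pos_def_mat d Q"
  shows "pos_def_mat d (inv_sqrt_mat d Q)"
    "inverts_mat (inv_sqrt_mat d Q * inv_sqrt_mat d Q) Q"
    "inverts_mat Q (inv_sqrt_mat d Q * inv_sqrt_mat d Q)"
proof -
  have Qc: "Q \<in> carrier_mat d d" using Q by (simp add: pos_def_mat_def)
  have "\<exists>!B. pos_def_mat d B \<and> inverts_mat (B * B) Q \<and> inverts_mat Q (B * B)"
  proof (rule ex_ex1I[OF pos_def_inv_sqrt_exists[OF Q]], elim conjE)
    fix B C assume B: "pos_def_mat d B" and C: "pos_def_mat d C"
      and "inverts_mat (B * B) Q" "inverts_mat Q (C * C)"
    then have "(B * B) * Q = 1\<^sub>m d" "Q * (C * C) = 1\<^sub>m d"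
      using Qc by (auto simp: inverts_mat_def pos_def_mat_def)
    moreover have "B * B \<in> carrier_mat d d" "C * C \<in> carrier_mat d d"
      using B C by (auto simp: pos_def_mat_def)
    ultimately have "B * B = C * C"
      using Qc assoc_mult_mat[of "B * B" d d Q d "C * C" d]
        left_mult_one_mat[of "C * C" d d] right_mult_one_mat[of "B * B" d d] by simp
    then show "B = C" by (rule pos_def_sqrt_unique[OF B C])
  qed
  then have "pos_def_mat d (inv_sqrt_mat d Q) \<and> inverts_mat (inv_sqrt_mat d Q * inv_sqrt_mat d Q) Q \<and>
      inverts_mat Q (inv_sqrt_mat d Q * inv_sqrt_mat d Q)"
    unfolding inv_sqrt_mat_def by (rule theI')
  then show "pos_def_mat d (inv_sqrt_mat d Q)"
    "inverts_mat (inv_sqrt_mat d Q * inv_sqrt_mat d Q) Q"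
    "inverts_mat Q (inv_sqrt_mat d Q * inv_sqrt_mat d Q)" by auto
qed

section \<open>Derivative of the determinant and sums of matrix families\<close>

text \<open>Only the identity permutation contributes at r = 0: any other one moves at least two
  indices, so after differentiating one factor an off-diagonal factor remains, and it vanishes
  there.\<close>

lemma det_one_plus_smult_has_derivative:
  fixes M :: "'a :: real_normed_field mat"
  assumes M: "M \<in> carrier_mat d d"
  shows "((\<lambda>r. det (1\<^sub>m d + r \<cdot>\<^sub>m M)) has_field_derivative (\<Sum>a<d. M $$ (a, a))) (at 0)"
proof -
  let ?N = "{0..<d}"
  let ?E = "\<lambda>r p i. (if i = p i then 1 else 0) + r * M $$ (i, p i)"
  let ?dp = "\<lambda>p. \<Sum>k\<in>?N. M $$ (k, p k) * (\<Prod>i\<in>?N - {k}. ?E 0 p i)"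
  have det: "det (1\<^sub>m d + r \<cdot>\<^sub>m M) = (\<Sum>p | p permutes ?N. signof p * (\<Prod>i\<in>?N. ?E r p i))" for r
  proof -
    have "1\<^sub>m d + r \<cdot>\<^sub>m M \<in> carrier_mat d d" using M by simp
    moreover have "(1\<^sub>m d + r \<cdot>\<^sub>m M) $$ (i, p i) = ?E r p i" if "p permutes ?N" "i \<in> ?N" for p i
      using that M permutes_in_image[OF that(1), of i] by simp
    ultimately show ?thesis by (auto simp: det_def' intro!: sum.cong prod.cong)
  qed
  have dp: "((\<lambda>r. \<Prod>i\<in>?N. ?E r p i) has_field_derivative ?dp p) (at 0)" for p
    by (rule derivative_eq_intros has_field_derivative_prod | simp)+
  have "?dp p = 0" if p: "p permutes ?N" "p \<noteq> id" for p
  proof (rule sum.neutral, rule ballI)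
    fix k assume "k \<in> ?N"
    obtain i where i: "p i \<noteq> i" using p(2) by (auto simp: fun_eq_iff)
    \<comment> \<open>A moved index other than \<open>k\<close>: if \<open>k\<close> itself is
      moved, then \<open>p k\<close> is moved as well, by injectivity.\<close>
    obtain j where j: "j \<in> ?N - {k}" "p j \<noteq> j"
    proof (cases "i = k")
      case True
      then have "p k \<noteq> k" "p (p k) \<noteq> p k" using i p(1) by (auto dest: permutes_inj injD)
      moreover have "p k \<in> ?N" using \<open>k \<in> ?N\<close> p(1) by (simp only: permutes_in_image)
      ultimately show ?thesis using that by blast
    next
      case False
      moreover have "i \<in> ?N" using i p(1) by (auto simp: permutes_def)
      ultimately show ?thesis using that i by blast
    qed
    then have "(\<Prod>i\<in>?N - {k}. ?E 0 p i) = 0"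
      by (intro prod_zero bexI[of _ j]) auto
    then show "M $$ (k, p k) * (\<Prod>i\<in>?N - {k}. ?E 0 p i) = 0" by simp
  qed
  then have "(\<Sum>p | p permutes ?N. signof p * ?dp p) =
      (\<Sum>p\<in>{p. p permutes ?N}. if p = id then signof id * ?dp id else 0)"
    by (intro sum.cong) auto
  also have "\<dots> = ?dp id" by (simp add: finite_permutations permutes_id sign_id)
  also have "\<dots> = (\<Sum>a<d. M $$ (a, a))" by (simp add: atLeast0LessThan)
  finally have "(\<Sum>p | p permutes ?N. signof p * ?dp p) = (\<Sum>a<d. M $$ (a, a))" .
  moreover have "((\<lambda>r. \<Sum>p | p permutes ?N. signof p * (\<Prod>i\<in>?N. ?E r p i))
      has_field_derivative (\<Sum>p | p permutes ?N. signof p * ?dp p)) (at 0)"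
    by (intro DERIV_sum DERIV_cmult dp)
  ultimately show ?thesis by (simp only: det)
qed

section \<open>Sums of matrix families and Gram forms\<close>

lemma mat_family_sum_carrier [simp]: "mat_family_sum d F I \<in> carrier_mat d d"
  by (simp add: mat_family_sum_def)

lemma mat_family_sum_cong:
  "(\<And>i. i \<in> I \<Longrightarrow> F i = G i) \<Longrightarrow> mat_family_sum d F I = mat_family_sum d G I"
  by (auto simp: mat_family_sum_def)

lemma mult_mat_family_sum:
  assumes "B \<in> carrier_mat m d" "C \<in> carrier_mat d m" "\<And>i. i \<in> I \<Longrightarrow> F i \<in> carrier_mat d d"
  shows "B * mat_family_sum d F I * C = mat_family_sum m (\<lambda>i. B * F i * C) I"
proof (rule eq_matI)
  fix a b assume "a < dim_row (mat_family_sum m (\<lambda>i. B * F i * C) I)"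
    "b < dim_col (mat_family_sum m (\<lambda>i. B * F i * C) I)"
  then have ab: "a < m" "b < m" by (auto simp: mat_family_sum_def)
  have entry: "(B * M * C) $$ (a, b) = (\<Sum>l<d. (\<Sum>k<d. B $$ (a, k) * M $$ (k, l)) * C $$ (l, b))"
    if "M \<in> carrier_mat d d" for M
    using that assms(1,2) ab
    by (auto simp: scalar_prod_def atLeast0LessThan simp del: assoc_mult_mat intro!: sum.cong)
  have "(B * mat_family_sum d F I * C) $$ (a, b) =
      (\<Sum>l<d. (\<Sum>k<d. B $$ (a, k) * (\<Sum>i\<in>I. F i $$ (k, l))) * C $$ (l, b))"
    unfolding entry[OF mat_family_sum_carrier] by (simp add: mat_family_sum_def)
  also have "\<dots> = (\<Sum>l<d. \<Sum>k<d. \<Sum>i\<in>I. B $$ (a, k) * F i $$ (k, l) * C $$ (l, b))"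
    by (simp add: sum_distrib_left sum_distrib_right)
  also have "\<dots> = (\<Sum>l<d. \<Sum>i\<in>I. \<Sum>k<d. B $$ (a, k) * F i $$ (k, l) * C $$ (l, b))"
    by (intro sum.cong refl sum.swap)
  also have "\<dots> = (\<Sum>i\<in>I. \<Sum>l<d. \<Sum>k<d. B $$ (a, k) * F i $$ (k, l) * C $$ (l, b))"
    by (rule sum.swap)
  also have "\<dots> = (\<Sum>i\<in>I. (B * F i * C) $$ (a, b))"
    using assms(3) by (simp add: entry sum_distrib_right)
  finally show "(B * mat_family_sum d F I * C) $$ (a, b) = mat_family_sum m (\<lambda>i. B * F i * C) I $$ (a, b)"
    using ab by (simp add: mat_family_sum_def)
qed (use assms in \<open>auto simp: mat_family_sum_def\<close>)

lemma scalar_prod_mat_family_sum: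
  assumes v: "v \<in> carrier_vec d" and F: "\<And>i. i \<in> I \<Longrightarrow> F i \<in> carrier_mat d d"
  shows "v \<bullet> (mat_family_sum d F I *\<^sub>v v) = (\<Sum>i\<in>I. v \<bullet> (F i *\<^sub>v v))"
proof -
  have entry: "v \<bullet> (M *\<^sub>v v) = (\<Sum>k<d. \<Sum>l<d. v $ k * (M $$ (k, l) * v $ l))"
    if "M \<in> carrier_mat d d" for M
  proof -
    have "dim_row M = d" "dim_col M = d" "dim_vec v = d" using that v by auto
    then show ?thesis by (simp add: scalar_prod_def atLeast0LessThan sum_distrib_left)
  qed
  have "v \<bullet> (mat_family_sum d F I *\<^sub>v v) = (\<Sum>k<d. \<Sum>l<d. \<Sum>i\<in>I. v $ k * (F i $$ (k, l) * v $ l))"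
    unfolding entry[OF mat_family_sum_carrier]
    by (simp add: mat_family_sum_def sum_distrib_left sum_distrib_right)
  also have "\<dots> = (\<Sum>k<d. \<Sum>i\<in>I. \<Sum>l<d. v $ k * (F i $$ (k, l) * v $ l))"
    by (intro sum.cong refl sum.swap)
  also have "\<dots> = (\<Sum>i\<in>I. \<Sum>k<d. \<Sum>l<d. v $ k * (F i $$ (k, l) * v $ l))"
    by (rule sum.swap)
  finally show ?thesis using F by (simp add: entry)
qed

lemma smult_mat_mult_vec:
  fixes A :: "'a :: comm_semiring_0 mat"
  assumes "A \<in> carrier_mat m k" "v \<in> carrier_vec k"
  shows "(x \<cdot>\<^sub>m A) *\<^sub>v v = x \<cdot>\<^sub>v (A *\<^sub>v v)"
proof -
  have "dim_row A = m" "dim_col A = k" "dim_vec v = k" using assms by auto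
  then show ?thesis
    by (intro eq_vecI) (simp_all add: scalar_prod_def sum_distrib_left mult.assoc)
qed

lemma scalar_prod_gram:
  fixes X :: "'a :: comm_semiring_0 mat"
  assumes X: "X \<in> carrier_mat d k" and v: "v \<in> carrier_vec d"
  shows "v \<bullet> ((X * X\<^sup>T) *\<^sub>v v) = (X\<^sup>T *\<^sub>v v) \<bullet> (X\<^sup>T *\<^sub>v v)"
proof -
  have "v \<bullet> ((X * X\<^sup>T) *\<^sub>v v) = v \<bullet> (X *\<^sub>v (X\<^sup>T *\<^sub>v v))"
    using X v by (simp add: assoc_mult_mat_vec[of _ d k _ d])
  also have "\<dots> = (X *\<^sub>v (X\<^sup>T *\<^sub>v v)) \<bullet> v"
    using X v by (intro comm_scalar_prod[of _ d]) auto
  also have "\<dots> = (X\<^sup>T *\<^sub>v v) \<bullet> (X\<^sup>T *\<^sub>v v)"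
    using X v transpose_vec_mult_scalar[of "X\<^sup>T" k d v "X\<^sup>T *\<^sub>v v"] by simp
  finally show ?thesis .
qed

text \<open>With B the inverse square root, B B Q = 1 gives (det B)^2 det Q = 1.\<close>

lemma det_pos_def_pos:
  assumes Q: "pos_def_mat d Q"
  shows "0 < det Q"
proof -
  let ?B = "inv_sqrt_mat d Q"
  have B: "?B \<in> carrier_mat d d" and Qc: "Q \<in> carrier_mat d d"
    using inv_sqrt_mat(1)[OF Q] Q by (auto simp: pos_def_mat_def)
  have "?B * ?B * Q = 1\<^sub>m d" using inv_sqrt_mat(2)[OF Q] B by (simp add: inverts_mat_def)
  then have "det (?B * ?B * Q) = 1" by simp
  then have "det ?B * det ?B * det Q = 1"
    using B Qc by (simp add: det_mult[of _ d])
  then show ?thesis using mult_nonneg_nonpos[of "det ?B * det ?B" "det Q"] by force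
qed

section \<open>Critical points of the frame potential\<close>

text \<open>The exponent of the i-th variable in \<open>sel_monom\<close>. The explicit 0 outside
  the index set, where the extensional family has no meaningful value, makes the logarithm of the
  monomial a linear form in all n coordinates.\<close>

definition sel_mult :: "nat \<Rightarrow> nat set \<times> (nat \<Rightarrow> nat set) \<Rightarrow> real" where
  "sel_mult i s = (if i \<in> fst s then real (card (snd s i)) else 0)"

lemma sel_monom_exp:
  assumes s: "s \<in> selections d n ds" and t: "t \<in> carrier_vec n"
  shows "sel_monom (map_vec exp t) s = exp (\<Sum>i<n. t $ i * sel_mult i s)"
proof -
  obtain I S where IS: "s = (I, S)" by fastforce
  have I: "I \<subseteq> {..<n}" "finite I"
    using s finite_subset[of I "{..<n}"] by (auto simp: IS selections_def)
  have "(\<Sum>i<n. t $ i * sel_mult i s) = (\<Sum>i\<in>I. t $ i * real (card (S i)))"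
    by (rule sum.mono_neutral_cong_right) (use I in \<open>auto simp: IS sel_mult_def\<close>)
  moreover have "sel_monom (map_vec exp t) s = (\<Prod>i\<in>I. exp (t $ i * real (card (S i))))"
    using I t by (auto simp: IS sel_monom_def exp_of_nat2_mult intro!: prod.cong)
  ultimately show ?thesis using I by (simp add: exp_sum)
qed

lemma finite_selections:
  assumes "0 < d"
  shows "finite (selections d n ds)"
proof -
  have "finite {K. K \<subseteq> Sigma {..<n} (\<lambda>i. {..<ds i}) \<and> card K = d}"
    by (rule finite_subset[of _ "Pow (Sigma {..<n} (\<lambda>i. {..<ds i}))"]) auto
  then show ?thesis using bij_betw_finite[OF bij_betw_selections[OF assms]] by blast
qed

context
  fixes d n :: nat and ds :: "nat \<Rightarrow> nat" and X :: "nat \<Rightarrow> real mat"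
  assumes frame: "matrix_frame d n ds X" and d: "0 < d"
begin

lemma mat_tuple_frame: "mat_tuple d n ds X"
  using frame by (simp add: matrix_frame_def)

lemma frame_mat_carrier: "i < n \<Longrightarrow> X i \<in> carrier_mat d (ds i)"
  using mat_tuple_frame by (simp add: mat_tuple_def)

lemma frame_gram_carrier [simp]: "i < n \<Longrightarrow> X i * (X i)\<^sup>T \<in> carrier_mat d d"
  by (rule mult_carrier_mat[of _ d "ds i"]) (auto dest: frame_mat_carrier)

text \<open>The frame hypothesis is the case of unit weights. For v nonzero it makes some |X_i^T
  v|^2 positive, and positive weights keep that term positive and the others nonnegative.\<close>

lemma pos_def_frame_op: "pos_def_mat d (frame_op d n X t)"
proof -
  let ?q = "\<lambda>i v. ((X i)\<^sup>T *\<^sub>v v) \<bullet> ((X i)\<^sup>T *\<^sub>v v)"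
  have q0: "0 \<le> ?q i v" for i v
    by (simp add: scalar_prod_def sum_nonneg)
  have "0 < v \<bullet> (frame_op d n X t *\<^sub>v v)" if v: "v \<in> carrier_vec d" "v \<noteq> 0\<^sub>v d" for v
  proof -
    have "0 < v \<bullet> (mat_family_sum d (\<lambda>i. X i * (X i)\<^sup>T) {..<n} *\<^sub>v v)"
      using frame v by (simp add: matrix_frame_def pos_def_mat_def)
    also have "\<dots> = (\<Sum>i<n. v \<bullet> ((X i * (X i)\<^sup>T) *\<^sub>v v))"
      by (rule scalar_prod_mat_family_sum[OF v(1)]) simp
    also have "\<dots> = (\<Sum>i<n. ?q i v)"
      by (rule sum.cong[OF refl], rule scalar_prod_gram[OF frame_mat_carrier v(1)]) simp
    finally have "0 < (\<Sum>i<n. ?q i v)" .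
    then obtain i where i: "i < n" "0 < ?q i v"
      by (metis (no_types, lifting) lessThan_iff less_le_not_le sum_nonpos linorder_not_le)
    have "0 < (\<Sum>i<n. exp (t $ i) * ?q i v)"
      by (rule sum_pos2[of _ i]) (use i q0 in auto)
    also have "\<dots> = (\<Sum>i<n. v \<bullet> ((exp (t $ i) \<cdot>\<^sub>m (X i * (X i)\<^sup>T)) *\<^sub>v v))"
    proof (rule sum.cong[OF refl])
      fix i assume "i \<in> {..<n}"
      then have i: "i < n" by simp
      have "(exp (t $ i) \<cdot>\<^sub>m (X i * (X i)\<^sup>T)) *\<^sub>v v = exp (t $ i) \<cdot>\<^sub>v ((X i * (X i)\<^sup>T) *\<^sub>v v)"
        using frame_gram_carrier[OF i] v(1) by (rule smult_mat_mult_vec)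
      moreover have "(X i * (X i)\<^sup>T) *\<^sub>v v \<in> carrier_vec d"
        using frame_gram_carrier[OF i] v(1) by (rule mult_mat_vec_carrier)
      ultimately show "exp (t $ i) * ?q i v = v \<bullet> ((exp (t $ i) \<cdot>\<^sub>m (X i * (X i)\<^sup>T)) *\<^sub>v v)"
        using v(1) scalar_prod_gram[OF frame_mat_carrier[OF i] v(1)] by simp
    qed
    also have "\<dots> = v \<bullet> (frame_op d n X t *\<^sub>v v)"
      unfolding frame_op_def using v(1) by (subst scalar_prod_mat_family_sum) auto
    finally show ?thesis .
  qed
  moreover have "(frame_op d n X t)\<^sup>T = frame_op d n X t"
  proof (rule eq_matI)
    fix a b assume "a < dim_row (frame_op d n X t)" "b < dim_col (frame_op d n X t)"
    then have ab: "a < d" "b < d" by (auto simp: frame_op_def mat_family_sum_def)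
    have sym: "(x \<cdot>\<^sub>m (X i * (X i)\<^sup>T)) $$ (b, a) = (x \<cdot>\<^sub>m (X i * (X i)\<^sup>T)) $$ (a, b)"
      if "i < n" for i x
    proof -
      have "dim_row (X i) = d" "dim_col (X i) = ds i" using frame_mat_carrier[OF that] by auto
      then show ?thesis using ab by (simp add: scalar_prod_def mult.commute)
    qed
    then show "(frame_op d n X t)\<^sup>T $$ (a, b) = frame_op d n X t $$ (a, b)"
      using ab by (auto simp: frame_op_def mat_family_sum_def sym simp del: index_smult_mat(1)
          intro!: sum.cong)
  qed (auto simp: frame_op_def mat_family_sum_def)
  ultimately show ?thesis
    by (simp add: pos_def_mat_def frame_op_def)
qed

lemma det_frame_op_pos: "0 < det (frame_op d n X t)"
  by (rule det_pos_def_pos[OF pos_def_frame_op])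

lemma det_frame_op:
  assumes t: "t \<in> carrier_vec n"
  shows "det (frame_op d n X t) =
    (\<Sum>s\<in>selections d n ds. sel_monom (map_vec exp t) s * sel_det d X s)"
proof -
  have "frame_op d n X t = mat_family_sum d (\<lambda>i. map_vec exp t $ i \<cdot>\<^sub>m (X i * (X i)\<^sup>T)) {..<n}"
    unfolding frame_op_def by (rule mat_family_sum_cong) (use t in auto)
  then show ?thesis by (simp add: det_weighted_frame_sum[OF mat_tuple_frame d])
qed

lemma det_frame_op_exp:
  assumes t: "t \<in> carrier_vec n"
  shows "det (frame_op d n X t) =
    (\<Sum>s\<in>selections d n ds. sel_det d X s * exp (\<Sum>i<n. t $ i * sel_mult i s))"
  unfolding det_frame_op[OF t]
  by (rule sum.cong) (simp_all add: sel_monom_exp[OF _ t])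

text \<open>The i-th partial derivative of det Q, taken termwise in the exponential sum; it is also
  the left-hand side of the i-th equation of the variety at \<open>map_vec exp t\<close>.\<close>

definition det_grad :: "real vec \<Rightarrow> nat \<Rightarrow> real" where
  "det_grad t i = (\<Sum>s\<in>selections d n ds.
     sel_det d X s * exp (\<Sum>i<n. t $ i * sel_mult i s) * sel_mult i s)"

lemma frame_variety_iff:
  assumes t: "t \<in> carrier_vec n"
  shows "map_vec exp t \<in> frame_variety d n ds X c \<longleftrightarrow>
    (\<forall>i<n. det_grad t i = c $ i * det (frame_op d n X t))"
proof -
  have "(\<Sum>s \<in> {s \<in> selections d n ds. i \<in> fst s}.
        real (card (snd s i)) * sel_monom (map_vec exp t) s * sel_det d X s) = det_grad t i" for i
    unfolding det_grad_def
    by (rule sum.mono_neutral_cong_left)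
      (auto simp: finite_selections[OF d] sel_mult_def sel_monom_exp[OF _ t])
  then show ?thesis using t by (simp add: frame_variety_def det_frame_op[OF t])
qed

text \<open>Restricting to a coordinate line keeps all differentiation in one real variable: each
  summand is a constant times exp of a multiple of \<open>x\<close>.\<close>

lemma det_frame_op_add_unit:
  assumes t: "t \<in> carrier_vec n" and i: "i < n"
  shows "det (frame_op d n X (t + x \<cdot>\<^sub>v unit_vec n i)) =
    (\<Sum>s\<in>selections d n ds. sel_det d X s * exp (\<Sum>i<n. t $ i * sel_mult i s) * exp (x * sel_mult i s))"
proof -
  have "(\<Sum>j<n. (t + x \<cdot>\<^sub>v unit_vec n i) $ j * sel_mult j s) =
      (\<Sum>j<n. t $ j * sel_mult j s) + x * sel_mult i s" for s
  proof -
    have "(\<Sum>j<n. (t + x \<cdot>\<^sub>v unit_vec n i) $ j * sel_mult j s) =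
        (\<Sum>j<n. t $ j * sel_mult j s + (if j = i then x * sel_mult i s else 0))"
      using t i by (intro sum.cong) (auto simp: algebra_simps)
    then show ?thesis using i by (simp add: sum.distrib)
  qed
  then show ?thesis
    using t by (subst det_frame_op_exp) (auto simp: exp_add mult_ac)
qed

lemma det_frame_op_has_derivative:
  assumes "t \<in> carrier_vec n" "i < n"
  shows "((\<lambda>x. det (frame_op d n X (t + x \<cdot>\<^sub>v unit_vec n i))) has_field_derivative det_grad t i) (at 0)"
  unfolding det_frame_op_add_unit[OF assms] det_grad_def
  by (rule derivative_eq_intros | simp add: mult_ac)+

section \<open>Minimisers of the potential are its critical points\<close>

lemma frame_inf_attained_iff:
  assumes t: "t \<in> carrier_vec n"
  shows "(\<bar>frame_inf d n X c\<bar> \<noteq> \<infinity> \<and> frame_inf d n X c = ereal (frame_potential d n X t - t \<bullet> c)) \<longleftrightarrow>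
    (\<forall>u\<in>carrier_vec n. frame_potential d n X t - t \<bullet> c \<le> frame_potential d n X u - u \<bullet> c)"
    (is "?L \<longleftrightarrow> ?R")
proof
  assume ?L
  then have "ereal (frame_potential d n X t - t \<bullet> c) \<le> ereal (frame_potential d n X u - u \<bullet> c)"
    if "u \<in> carrier_vec n" for u
    using that INF_lower[of u "carrier_vec n" "\<lambda>t. ereal (frame_potential d n X t - t \<bullet> c)"]
    by (simp add: frame_inf_def)
  then show ?R by simp
next
  assume ?R
  then have "frame_inf d n X c = ereal (frame_potential d n X t - t \<bullet> c)"
    unfolding frame_inf_def using t by (intro antisym INF_greatest INF_lower) auto
  then show ?L by simp
qed

text \<open>Jensen's inequality for the exponential, from averaging \<open>1 + y \<le> exp y\<close> over the selections.\<close>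

lemma critical_point_minimal:
  assumes t: "t \<in> carrier_vec n" and u: "u \<in> carrier_vec n" and c: "c \<in> carrier_vec n"
    and crit: "\<And>i. i < n \<Longrightarrow> det_grad t i = c $ i * det (frame_op d n X t)"
  shows "frame_potential d n X t - t \<bullet> c \<le> frame_potential d n X u - u \<bullet> c"
proof -
  let ?P = "\<lambda>t. det (frame_op d n X t)"
  define a where "a s = sel_det d X s * exp (\<Sum>i<n. t $ i * sel_mult i s)" for s
  define y where "y s = (\<Sum>i<n. (u $ i - t $ i) * sel_mult i s)" for s
  define m where "m = (\<Sum>i<n. (u $ i - t $ i) * c $ i)"
  have a: "0 \<le> a s" if "s \<in> selections d n ds" for s
    using sel_det_nonneg[OF mat_tuple_frame that] by (simp add: a_def)
  have Pt: "?P t = sum a (selections d n ds)" by (simp add: det_frame_op_exp[OF t] a_def)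
  have ay: "(\<Sum>s\<in>selections d n ds. a s * y s) = m * ?P t"
  proof -
    have "(\<Sum>s\<in>selections d n ds. a s * y s) =
        (\<Sum>i<n. \<Sum>s\<in>selections d n ds. a s * ((u $ i - t $ i) * sel_mult i s))"
      by (subst sum.swap) (simp add: y_def sum_distrib_left)
    also have "\<dots> = (\<Sum>i<n. (u $ i - t $ i) * det_grad t i)"
      by (simp add: det_grad_def a_def sum_distrib_left mult_ac)
    also have "\<dots> = m * ?P t"
      by (simp add: crit m_def sum_distrib_right mult.assoc)
    finally show ?thesis .
  qed
  \<comment> \<open>By \<open>ay\<close>, the critical equations say that \<open>m\<close> is the
    mean of \<open>y\<close> under the weights \<open>a\<close>, so the linear term y - m sums to
    zero. The centring makes the tangent inequality sharp enough.\<close>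
  have "?P t = (\<Sum>s\<in>selections d n ds. a s * (1 + (y s - m)))"
    by (simp add: algebra_simps sum.distrib sum_subtractf ay Pt flip: sum_distrib_left sum_distrib_right)
  also have "\<dots> \<le> (\<Sum>s\<in>selections d n ds. a s * exp (y s - m))"
    by (intro sum_mono mult_left_mono exp_ge_add_one_self a)
  also have "\<dots> = ?P u * exp (- m)"
  proof -
    have "a s * exp (y s) = sel_det d X s * exp (\<Sum>i<n. u $ i * sel_mult i s)" for s
      by (simp add: a_def y_def exp_add[symmetric] sum.distrib[symmetric] algebra_simps)
    then show ?thesis
      by (simp add: det_frame_op_exp[OF u] sum_distrib_right exp_diff exp_minus divide_inverse mult.assoc[symmetric])
  qed
  finally have "ln (?P t) \<le> ln (?P u * exp (- m))"
    using det_frame_op_pos by (subst ln_le_cancel_iff) (auto intro: mult_pos_pos)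
  also have "\<dots> = ln (?P u) - m" using det_frame_op_pos[of u] by (simp add: ln_mult_pos)
  also have "m = u \<bullet> c - t \<bullet> c"
    using t u c by (simp add: m_def scalar_prod_def atLeast0LessThan left_diff_distrib sum_subtractf)
  finally show ?thesis by (simp add: frame_potential_def)
qed

lemma minimal_critical_point:
  assumes t: "t \<in> carrier_vec n" and c: "c \<in> carrier_vec n" and i: "i < n"
    and min: "\<And>u. u \<in> carrier_vec n \<Longrightarrow>
      frame_potential d n X t - t \<bullet> c \<le> frame_potential d n X u - u \<bullet> c"
  shows "det_grad t i = c $ i * det (frame_op d n X t)"
proof -
  let ?p = "\<lambda>x. t + x \<cdot>\<^sub>v unit_vec n i"
  let ?\<phi> = "\<lambda>x. ln (det (frame_op d n X (?p x))) - x * c $ i"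
  have p0: "?p 0 = t" using t by (auto intro!: eq_vecI)
  have "(?\<phi> has_field_derivative det_grad t i / det (frame_op d n X t) - c $ i) (at 0)"
    by (rule derivative_eq_intros det_frame_op_has_derivative[OF t i] refl
      | simp add: p0 det_frame_op_pos)+
  moreover have "?\<phi> 0 \<le> ?\<phi> x" for x
  proof -
    have "?p x \<bullet> c = t \<bullet> c + x * c $ i"
      using t c i by (simp add: add_scalar_prod_distrib[of _ n])
    then show ?thesis using min[of "?p x"] t by (simp add: p0 frame_potential_def)
  qed
  \<comment> \<open>The instantiated \<open>d\<close> is the radius of the neighbourhood in the
    library rule, not the dimension; the minimum is global on the line, so radius 1 serves.\<close>
  ultimately have "det_grad t i / det (frame_op d n X t) - c $ i = 0"
    by (intro DERIV_local_min[where d = 1]) auto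
  then show ?thesis using det_frame_op_pos[of t] by (simp add: field_simps)
qed

section \<open>Normalisation by the inverse square root\<close>

lemma inv_sqrt_normalizes:
  fixes t :: "real vec"
  defines "A \<equiv> inv_sqrt_mat d (frame_op d n X t)"
  shows "A \<in> carrier_mat d d" "A\<^sup>T = A" "A * frame_op d n X t * A = 1\<^sub>m d" "invertible_mat A"
proof -
  let ?Q = "frame_op d n X t"
  note inv = inv_sqrt_mat[OF pos_def_frame_op, of t, folded A_def]
  have Q: "?Q \<in> carrier_mat d d" by (simp add: frame_op_def)
  show A: "A \<in> carrier_mat d d" and "A\<^sup>T = A" using inv(1) by (auto simp: pos_def_mat_def)
  have AQ: "A * ?Q \<in> carrier_mat d d" using A Q by simp
  have "A * A * ?Q = 1\<^sub>m d" using inv(2) A by (simp add: inverts_mat_def)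
  \<comment> \<open>Reading A A Q = 1 as a one-sided inverse relation between A and AQ, squareness
    lets the factors be swapped, which gives A Q A = 1 and the invertibility of A at once.\<close>
  then have right: "A * (A * ?Q) = 1\<^sub>m d" using assoc_mult_mat[OF A A Q] by simp
  then show left: "A * ?Q * A = 1\<^sub>m d" by (rule mat_mult_left_right_inverse[OF A AQ])
  have "dim_row A = d" "dim_row (A * ?Q) = d" "square_mat A" using A by auto
  then show "invertible_mat A"
    using left right unfolding invertible_mat_def inverts_mat_def by metis
qed

lemma mult_gram_mult:
  assumes A: "A \<in> carrier_mat d d" "A\<^sup>T = A" and i: "i < n"
  shows "A * (x \<cdot>\<^sub>m (X i * (X i)\<^sup>T)) * A = x \<cdot>\<^sub>m ((A * X i) * (A * X i)\<^sup>T)"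
proof -
  have X: "X i \<in> carrier_mat d (ds i)" and XT: "(X i)\<^sup>T \<in> carrier_mat (ds i) d"
    using frame_mat_carrier[OF i] by auto
  have "(A * X i) * (A * X i)\<^sup>T = (A * X i) * ((X i)\<^sup>T * A)"
    using transpose_mult[OF A(1) X] A(2) by simp
  also have "\<dots> = A * X i * (X i)\<^sup>T * A"
    by (rule assoc_mult_mat[symmetric, of _ d "ds i" _ d]) (use A X in auto)
  also have "A * X i * (X i)\<^sup>T = A * (X i * (X i)\<^sup>T)"
    by (rule assoc_mult_mat[OF A(1) X XT])
  finally show ?thesis
    using A(1) frame_gram_carrier[OF i]
    by (simp add: mult_smult_distrib[of _ d d _ d] mult_smult_assoc_mat[of _ d d _ d])
qed

text \<open>Conjugation by \<open>A\<close> moves the base point to the identity, where the derivative of the determinant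
  is the trace.\<close>

lemma det_grad_eq_frobenius:
  assumes t: "t \<in> carrier_vec n" and i: "i < n"
  defines "A \<equiv> inv_sqrt_mat d (frame_op d n X t)"
  shows "det_grad t i = det (frame_op d n X t) * (exp (t $ i) * (frobenius_norm (A * X i))\<^sup>2)"
proof -
  let ?Q = "frame_op d n X t" and ?Y = "X i * (X i)\<^sup>T" and ?M = "(A * X i) * (A * X i)\<^sup>T"
  \<comment> \<open>Moving the i-th coordinate by \<open>x\<close> changes only the i-th weight, by
    exp(t_i + x) - exp(t_i) = \<open>r x\<close>. Here r(0) = 0 and r'(0) = exp(t_i), the data for
    the chain rule below.\<close>
  define r where "r x = (exp x - 1) * exp (t $ i)" for x
  note A = inv_sqrt_normalizes[of t, folded A_def]
  have Q: "?Q \<in> carrier_mat d d" by (simp add: frame_op_def)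
  have AX: "A * X i \<in> carrier_mat d (ds i)" using A(1) frame_mat_carrier[OF i] by simp
  then have M: "?M \<in> carrier_mat d d" by simp
  have perturb: "frame_op d n X (t + x \<cdot>\<^sub>v unit_vec n i) = ?Q + r x \<cdot>\<^sub>m ?Y" for x
  proof (rule eq_matI)
    fix a b assume "a < dim_row (?Q + r x \<cdot>\<^sub>m ?Y)" "b < dim_col (?Q + r x \<cdot>\<^sub>m ?Y)"
    then have ab: "a < d" "b < d" using frame_mat_carrier[OF i] by auto
    have entry: "(y \<cdot>\<^sub>m (X j * (X j)\<^sup>T)) $$ (a, b) = y * (X j * (X j)\<^sup>T) $$ (a, b)" if "j < n" for y j
      using ab frame_gram_carrier[OF that] by (intro index_smult_mat(1)) auto
    have weight: "exp ((t + x \<cdot>\<^sub>v unit_vec n i) $ j) * y = exp (t $ j) * y + (if j = i then r x * y else 0)"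
      if "j < n" for j y
      using t i that by (auto simp: exp_add r_def algebra_simps)
    have "frame_op d n X (t + x \<cdot>\<^sub>v unit_vec n i) $$ (a, b) =
        (\<Sum>j<n. exp (t $ j) * (X j * (X j)\<^sup>T) $$ (a, b) + (if j = i then r x * ?Y $$ (a, b) else 0))"
      unfolding frame_op_def mat_family_sum_def index_mat(1)[OF ab] prod.case
      by (intro sum.cong refl) (simp only: entry weight lessThan_iff cong: if_cong)
    also have "\<dots> = ?Q $$ (a, b) + r x * ?Y $$ (a, b)"
      using ab i by (simp add: frame_op_def mat_family_sum_def entry sum.distrib
          del: index_mult_mat(1) index_smult_mat(1))
    also have "\<dots> = (?Q + r x \<cdot>\<^sub>m ?Y) $$ (a, b)"
    proof -
      have "dim_row (r x \<cdot>\<^sub>m ?Y) = d" "dim_col (r x \<cdot>\<^sub>m ?Y) = d"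
        using frame_mat_carrier[OF i] by auto
      then have "(?Q + r x \<cdot>\<^sub>m ?Y) $$ (a, b) = ?Q $$ (a, b) + (r x \<cdot>\<^sub>m ?Y) $$ (a, b)"
        using ab by (intro index_add_mat(1)) auto
      then show ?thesis by (simp only: entry[OF i])
    qed
    finally show "frame_op d n X (t + x \<cdot>\<^sub>v unit_vec n i) $$ (a, b) = (?Q + r x \<cdot>\<^sub>m ?Y) $$ (a, b)" .
  qed (use frame_mat_carrier[OF i] in \<open>auto simp: frame_op_def mat_family_sum_def\<close>)
  have det_A: "det A * det ?Q * det A = 1"
    using A(1,3) Q det_mult[of "A * ?Q" d A] det_mult[of A d ?Q] by simp
  have "det (?Q + r x \<cdot>\<^sub>m ?Y) = det ?Q * det (1\<^sub>m d + r x \<cdot>\<^sub>m ?M)" for x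
  proof -
    have rY: "r x \<cdot>\<^sub>m ?Y \<in> carrier_mat d d" using frame_gram_carrier[OF i] by (rule smult_carrier_mat)
    have "A * (?Q + r x \<cdot>\<^sub>m ?Y) * A = A * ?Q * A + A * (r x \<cdot>\<^sub>m ?Y) * A"
      using A(1) Q rY by (simp add: mult_add_distrib_mat[of _ d d] add_mult_distrib_mat[of _ d d])
    also have "\<dots> = 1\<^sub>m d + r x \<cdot>\<^sub>m ?M" by (simp only: A(3) mult_gram_mult[OF A(1,2) i])
    finally have "det A * det (?Q + r x \<cdot>\<^sub>m ?Y) * det A = det (1\<^sub>m d + r x \<cdot>\<^sub>m ?M)"
      using A(1) Q rY det_mult[of "A * (?Q + r x \<cdot>\<^sub>m ?Y)" d A] det_mult[of A d "?Q + r x \<cdot>\<^sub>m ?Y"]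
      by simp
    then have "det ?Q * det (1\<^sub>m d + r x \<cdot>\<^sub>m ?M) = (det A * det ?Q * det A) * det (?Q + r x \<cdot>\<^sub>m ?Y)"
      by (simp add: mult_ac)
    then show ?thesis by (simp add: det_A)
  qed
  then have "((\<lambda>x. det (frame_op d n X (t + x \<cdot>\<^sub>v unit_vec n i))) =
      (\<lambda>x. det ?Q * det (1\<^sub>m d + r x \<cdot>\<^sub>m ?M)))"
    by (simp add: perturb)
  moreover have "((\<lambda>x. det (1\<^sub>m d + r x \<cdot>\<^sub>m ?M)) has_field_derivative
      (\<Sum>a<d. ?M $$ (a, a)) * exp (t $ i)) (at 0)"
  proof -
    have outer: "((\<lambda>y. det (1\<^sub>m d + y \<cdot>\<^sub>m ?M)) has_field_derivative (\<Sum>a<d. ?M $$ (a, a))) (at (r 0))"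
      using det_one_plus_smult_has_derivative[OF M] by (simp add: r_def)
    have inner: "(r has_field_derivative exp (t $ i)) (at 0)"
      unfolding r_def by (rule derivative_eq_intros refl | simp)+
    show ?thesis by (rule DERIV_chain2[OF outer inner])
  qed
  ultimately have "((\<lambda>x. det (frame_op d n X (t + x \<cdot>\<^sub>v unit_vec n i))) has_field_derivative
      det ?Q * ((\<Sum>a<d. ?M $$ (a, a)) * exp (t $ i))) (at 0)"
    by (simp only: DERIV_cmult)
  \<comment> \<open>Two derivatives of the same function at 0 meet here: the termwise one from the
    selections and the trace from the conjugated determinant.\<close>
  then have "det_grad t i = det ?Q * ((\<Sum>a<d. ?M $$ (a, a)) * exp (t $ i))"
    using det_frame_op_has_derivative[OF t i] DERIV_unique by blast
  moreover have "(\<Sum>a<d. ?M $$ (a, a)) = (frobenius_norm (A * X i))\<^sup>2"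
  proof -
    have dims: "dim_row (A * X i) = d" "dim_col (A * X i) = ds i" using AX by auto
    have "?M $$ (a, a) = (\<Sum>j<ds i. ((A * X i) $$ (a, j))\<^sup>2)" if "a < d" for a
      using that dims by (simp add: scalar_prod_def atLeast0LessThan power2_eq_square
          del: index_mult_mat(2,3))
    then show ?thesis unfolding frobenius_norm_def dims by (simp add: sum_nonneg)
  qed
  ultimately show ?thesis by (simp add: mult.commute)
qed

lemma critical_point_transforms:
  assumes t: "t \<in> carrier_vec n" and pos: "\<And>i. i < n \<Longrightarrow> 0 < c $ i"
    and crit: "\<And>i. i < n \<Longrightarrow> det_grad t i = c $ i * det (frame_op d n X t)"
  shows "transforms_into_RIF d n ds X c (inv_sqrt_mat d (frame_op d n X t))"
proof -
  let ?Q = "frame_op d n X t"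
  define A where "A = inv_sqrt_mat d ?Q"
  note A = inv_sqrt_normalizes[of t, folded A_def]
  have c: "c $ i = exp (t $ i) * (frobenius_norm (A * X i))\<^sup>2" if "i < n" for i
    using crit[OF that] det_grad_eq_frobenius[OF t that, folded A_def] det_frame_op_pos[of t] by simp
  \<comment> \<open>Positivity of c_i enters here: c_i = exp(t_i) |A X_i|^2 rules out A X_i = 0 and
    justifies the division by the norm.\<close>
  have norm: "frobenius_norm (A * X i) \<noteq> 0" if "i < n" for i
    using pos[OF that] c[OF that] by auto
  have "A * X i \<noteq> 0\<^sub>m d (ds i)" if "i < n" for i
  proof
    assume "A * X i = 0\<^sub>m d (ds i)"
    then show False using norm[OF that] by (simp add: frobenius_norm_def)
  qed
  moreover have "mat_family_sum d
      (\<lambda>i. (c $ i / (frobenius_norm (A * X i))\<^sup>2) \<cdot>\<^sub>m ((A * X i) * (A * X i)\<^sup>T)) {..<n} = 1\<^sub>m d"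
  proof -
    have "mat_family_sum d
        (\<lambda>i. (c $ i / (frobenius_norm (A * X i))\<^sup>2) \<cdot>\<^sub>m ((A * X i) * (A * X i)\<^sup>T)) {..<n} =
        mat_family_sum d (\<lambda>i. A * (exp (t $ i) \<cdot>\<^sub>m (X i * (X i)\<^sup>T)) * A) {..<n}"
    proof (rule mat_family_sum_cong)
      fix i assume "i \<in> {..<n}"
      then have i: "i < n" by simp
      have "c $ i / (frobenius_norm (A * X i))\<^sup>2 = exp (t $ i)" using c[OF i] norm[OF i] by simp
      then show "(c $ i / (frobenius_norm (A * X i))\<^sup>2) \<cdot>\<^sub>m ((A * X i) * (A * X i)\<^sup>T) =
          A * (exp (t $ i) \<cdot>\<^sub>m (X i * (X i)\<^sup>T)) * A"
        by (simp only: mult_gram_mult[OF A(1,2) i])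
    qed
    also have "\<dots> = A * ?Q * A"
      unfolding frame_op_def
      by (rule mult_mat_family_sum[symmetric]) (use A(1) in \<open>auto intro!: smult_carrier_mat\<close>)
    finally show ?thesis by (simp add: A(3))
  qed
  moreover have "mat_tuple d n ds (\<lambda>i. A * X i)"
    using A(1) frame_mat_carrier by (simp add: mat_tuple_def)
  ultimately show ?thesis
    using A(1,4) by (simp add: transforms_into_RIF_def radial_isotropic_def A_def)
qed

end

theorem theorem3:
  fixes d n :: nat and ds :: "nat \<Rightarrow> nat" and X :: "nat \<Rightarrow> real mat" and c t :: "real vec"
  assumes "0 < d" and "d < n" and "\<And>i. i < n \<Longrightarrow> 0 < ds i"
    and "matrix_frame d n ds X"
    and "c \<in> carrier_vec n"
    and "\<And>i. i < n \<Longrightarrow> c $ i \<in> \<rat>"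
    and "\<And>i. i < n \<Longrightarrow> 0 < c $ i"
    and "(\<Sum>i<n. c $ i) = real d"
    and "t \<in> carrier_vec n"
  shows "(\<bar>frame_inf d n X c\<bar> \<noteq> \<infinity> \<and>
            frame_inf d n X c = ereal (frame_potential d n X t - t \<bullet> c)
          \<longleftrightarrow> map_vec exp t \<in> frame_variety d n ds X c)
       \<and> ((\<bar>frame_inf d n X c\<bar> \<noteq> \<infinity> \<and>
            frame_inf d n X c = ereal (frame_potential d n X t - t \<bullet> c))
           \<or> map_vec exp t \<in> frame_variety d n ds X c
          \<longrightarrow> transforms_into_RIF d n ds X c (inv_sqrt_mat d (frame_op d n X t)))"
proof -
  note frame = \<open>matrix_frame d n ds X\<close> \<open>0 < d\<close>
  note t = \<open>t \<in> carrier_vec n\<close> and c = \<open>c \<in> carrier_vec n\<close>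
  have equiv: "\<bar>frame_inf d n X c\<bar> \<noteq> \<infinity> \<and>
      frame_inf d n X c = ereal (frame_potential d n X t - t \<bullet> c)
    \<longleftrightarrow> map_vec exp t \<in> frame_variety d n ds X c"
    unfolding frame_inf_attained_iff[OF frame t] frame_variety_iff[OF frame t]
    using minimal_critical_point[OF frame t c] critical_point_minimal[OF frame t _ c] by blast
  have "transforms_into_RIF d n ds X c (inv_sqrt_mat d (frame_op d n X t))"
    if "map_vec exp t \<in> frame_variety d n ds X c"
    using that critical_point_transforms[OF frame t assms(7)] frame_variety_iff[OF frame t] by blast
  then show ?thesis unfolding equiv by simp
qed

end
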